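(* Let $\beta\in(0,\pi/2)$, $A=\operatorname{Re}m_\infty(i)$, $B=-\operatorname{Im}m_\infty(i)$, $m=m_\infty(-0)$, $D=(A-m)^2+B^2$. Among all Schrödinger L-systems $\Theta_{\mu,h}$ ($\operatorname{Im}h>0$, $\mu\in\mathbb R\cup\{\infty\}$) whose main operator $T_h$ is $\beta$-sectorial, an L-system $\Theta_{\mu,h}$ has the maximum finite c-entropy $\mathcal S_{max}$ if and only if it is determined by the parameters $$h=(\cos\beta)\sqrt D-m+i(\sin\beta)\sqrt D\quad\text{and (arbitrary)}\quad\mu\in\mathbb R\cup\{\infty\}.$$ In this case, $$\mathcal S_{max}=-\frac12\ln\left(\frac{\sqrt D+(A-m)\cos\beta-B\sin\beta}{\sqrt D+(A-m)\cos\beta+B\sin\beta}\right).$$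
   Context: Setting. Let $\ell\in\mathbb R$, let $q$ be a (fixed) real locally summable function on $[\ell,+\infty)$, $l(y)=-y''+q(x)y$, $\mathcal H=L_2(\ell,+\infty)$. Let $D^*$ be the set of $y\in\mathcal H$ that are locally absolutely continuous together with $y'$ and satisfy $l(y)\in\mathcal H$. The minimal symmetric operator $\dot A y=l(y)$ with boundary conditions $y(\ell)=y'(\ell)=0$ is assumed to have deficiency indices $(1,1)$; $\operatorname{Dom}(\dot A^* )=D^*$, $\dot A^*y=l(y)$. For $h\in\mathbb C$ with $\operatorname{Im}h>0$, $T_h y=l(y)$ with domain $\{y\in D^*: y'(\ell)=hy(\ell)\}$. Weyl function. Let $\varphi_1,\varphi_2$ solve $l(\varphi_k)=\lambda\varphi_k$ with $\varphi_1(\ell,\lambda)=0,\varphi_1'(\ell,\lambda)=1$, $\varphi_2(\ell,\lambda)=-1,\varphi_2'(\ell,\lambda)=0$. The Weyl function $m_\infty(\lambda)$ is such that $\varphi_2(\cdot,\lambda)+m_\infty(\lambda)\varphi_1(\cdot,\lambda)\in L_2(\ell,+\infty)$. One has $\operatorname{Im}m_\infty(i)<0$. Standing assumptions: $\dot A$ is nonnegative, $(\dot Af,f)\ge0$ for $f\in\operatorname{Dom}(\dot A)$, and $m_\infty(-0):=\lim_{\lambda\to0,\lambda<0}m_\infty(\lambda)<\infty$. Schrödinger L-systems. $\mathcal H_+=D^*$ with $(y,z)_+=\int_\ell^\infty (y\bar z+l(y)\overline{l(z)})dx$, and $\mathcal H_+\subset\mathcal H\subset\mathcal H_-$ is the corresponding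 rigged triplet; $\delta(x-\ell),\delta'(x-\ell)\in\mathcal H_-$ act by $(y,\delta)=y(\ell)$, $(y,\delta')=-y'(\ell)$. For $\mu\in\mathbb R\cup\{\infty\}$ put $\mathbb A_{\mu,h}y=-y''+q y-\frac1{\mu-h}[y'(\ell)-hy(\ell)][\mu\delta(x-\ell)+\delta'(x-\ell)]$ and $g=\frac{(\operatorname{Im}h)^{1/2}}{|\mu-h|}[\mu\delta(x-\ell)+\delta'(x-\ell)]$ (limits as $\mu\to\infty$ if $\mu=\infty$), $Kc=cg$ for $c\in\mathbb C$; then $\operatorname{Im}\mathbb A_{\mu,h}=KK^*$. The array $\Theta_{\mu,h}=(\mathbb A_{\mu,h},K,1;\ \mathcal H_+\subset\mathcal H\subset\mathcal H_-,\mathbb C)$ is the Schrödinger L-system with main operator $T_h$ and state-space operator $\mathbb A_{\mu,h}$. Its transfer function is $W_{\Theta_{\mu,h}}(z)=I-2iK^*(\mathbb A_{\mu,h}-zI)^{-1}K=\frac{\mu-h}{\mu-\bar h}\cdot\frac{m_\infty(z)+\bar h}{m_\infty(z)+h}$ (limit as $\mu\to\infty$ if $\mu=\infty$). The c-entropy of $\Theta_{\mu,h}$ is $\mathcal S=-\ln|W_{\Theta_{\mu,h}}(-i)|$; it equals $-\ln|\kappa|$ where $|\kappa|=\left|\frac{m_\infty(i)+h}{m_\infty(i)+\bar h}\right|<1$ is the modulus of von Neumann's parameter of $T_h$. Sectoriality. A linear operator $T$ is accretive if $\operatorname{Re}(Tf,f)\ge0$ for all $f\in\operatorname{Dom}(T)$.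 An accretive $T$ is called $\beta$-sectorial, $\beta\in(0,\pi/2)$, if $(\cot\beta)|\operatorname{Im}(Tf,f)|\le\operatorname{Re}(Tf,f)$ for all $f\in\operatorname{Dom}(T)$, and throughout $\beta$ is the exact angle of sectoriality: $\tan\beta=\sup_{f\in\operatorname{Dom}(T)}\frac{|\operatorname{Im}(Tf,f)|}{\operatorname{Re}(Tf,f)}$. *)

theory Defs
  imports "HOL-Analysis.Analysis"
begin

type_synonym fn = "real \<Rightarrow> complex"

definition L2 :: "real \<Rightarrow> fn \<Rightarrow> bool" where
  "L2 l f \<longleftrightarrow> f \<in> borel_measurable (lebesgue_on {l..}) \<and>
             integrable (lebesgue_on {l..}) (\<lambda>x. (cmod (f x))\<^sup>2)"

definition ip :: "real \<Rightarrow> fn \<Rightarrow> fn \<Rightarrow> complex" where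
  "ip l f g = integral\<^sup>L (lebesgue_on {l..}) (\<lambda>x. f x * cnj (g x))"

definition loc_summable :: "real \<Rightarrow> (real \<Rightarrow> 'b::euclidean_space) \<Rightarrow> bool" where
  "loc_summable l f \<longleftrightarrow> (\<forall>b. f absolutely_integrable_on {l..b})"

text \<open>Local absolute continuity on the half-line means being an indefinite Lebesgue integral of a
  locally summable density. The density is unique almost everywhere; it is the derivative of the
  function almost everywhere.\<close>

definition ac_density :: "real \<Rightarrow> fn \<Rightarrow> fn \<Rightarrow> bool" where
  "ac_density l f g \<longleftrightarrow> loc_summable l g \<and> (\<forall>x\<ge>l. f x = f l + integral {l..x} g)"

definition loc_abs_continuous :: "real \<Rightarrow> fn \<Rightarrow> bool" where
  "loc_abs_continuous l f \<longleftrightarrow> (\<exists>g. ac_density l f g)"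

definition ac_deriv :: "real \<Rightarrow> fn \<Rightarrow> fn" where
  "ac_deriv l f = (SOME g. ac_density l f g)"

definition D1 :: "real \<Rightarrow> fn \<Rightarrow> fn" where
  "D1 l y x = vector_derivative y (at x within {l..})"

text \<open>A function that is locally absolutely continuous together with its derivative is continuously
  differentiable, so its first derivative is taken pointwise (one-sided at the left endpoint).\<close>

definition sl_regular :: "real \<Rightarrow> fn \<Rightarrow> bool" where
  "sl_regular l y \<longleftrightarrow> loc_abs_continuous l y \<and>
     (\<forall>x\<ge>l. y differentiable (at x within {l..})) \<and> loc_abs_continuous l (D1 l y)"

definition sl_expr :: "real \<Rightarrow> (real \<Rightarrow> real) \<Rightarrow> fn \<Rightarrow> fn" where
  "sl_expr l q y x = - ac_deriv l (D1 l y) x + complex_of_real (q x) * y x"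

text \<open>Functions on the half-line are extended by zero to the left of the endpoint, so that
  elements of the maximal domain that agree on the half-line are equal.\<close>

definition Dstar :: "real \<Rightarrow> (real \<Rightarrow> real) \<Rightarrow> fn set" where
  "Dstar l q = {y. (\<forall>x<l. y x = 0) \<and> L2 l y \<and> sl_regular l y \<and> L2 l (sl_expr l q y)}"

text \<open>An unbounded operator is a pair of its domain and its action.\<close>

type_synonym op_L2 = "fn set \<times> (fn \<Rightarrow> fn)"

definition max_op :: "real \<Rightarrow> (real \<Rightarrow> real) \<Rightarrow> op_L2" where
  "max_op l q = (Dstar l q, sl_expr l q)"

definition min_op :: "real \<Rightarrow> (real \<Rightarrow> real) \<Rightarrow> op_L2" where
  "min_op l q = ({y \<in> Dstar l q. y l = 0 \<and> D1 l y l = 0}, sl_expr l q)"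

definition T_op :: "real \<Rightarrow> (real \<Rightarrow> real) \<Rightarrow> complex \<Rightarrow> op_L2" where
  "T_op l q h = ({y \<in> Dstar l q. D1 l y l = h * y l}, sl_expr l q)"

text \<open>The maximal operator is the adjoint of the minimal one, so the defect subspaces of the minimal
  operator are eigenspaces of the maximal operator.\<close>

definition defect_space :: "real \<Rightarrow> (real \<Rightarrow> real) \<Rightarrow> complex \<Rightarrow> fn set" where
  "defect_space l q z = {y \<in> fst (max_op l q).
     AE x in lebesgue_on {l..}. snd (max_op l q) y x = z * y x}"

definition one_dimensional :: "fn set \<Rightarrow> bool" where
  "one_dimensional V \<longleftrightarrow> (\<exists>e. e \<noteq> (\<lambda>_. 0) \<and> V = {\<lambda>x. c * e x | c. True})"

definition deficiency_indices_1_1 :: "real \<Rightarrow> (real \<Rightarrow> real) \<Rightarrow> bool" where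
  "deficiency_indices_1_1 l q \<longleftrightarrow>
     one_dimensional (defect_space l q \<i>) \<and> one_dimensional (defect_space l q (- \<i>))"

definition nonnegative_op :: "real \<Rightarrow> op_L2 \<Rightarrow> bool" where
  "nonnegative_op l T \<longleftrightarrow> (\<forall>f \<in> fst T. ip l (snd T f) f \<in> \<real>\<^sub>\<ge>\<^sub>0)"

definition accretive :: "real \<Rightarrow> op_L2 \<Rightarrow> bool" where
  "accretive l T \<longleftrightarrow> (\<forall>f \<in> fst T. Re (ip l (snd T f) f) \<ge> 0)"

text \<open>Exact angle of sectoriality. The inequality forces the imaginary part to vanish where the real
  part does, so the quotients of the form 0/0 (which are 0) do not affect the supremum, and it also
  bounds the quotients from above.\<close>

definition sectorial :: "real \<Rightarrow> op_L2 \<Rightarrow> real \<Rightarrow> bool" where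
  "sectorial l T \<beta> \<longleftrightarrow> accretive l T \<and>
     (\<forall>f \<in> fst T. cot \<beta> * \<bar>Im (ip l (snd T f) f)\<bar> \<le> Re (ip l (snd T f) f)) \<and>
     tan \<beta> = (SUP f \<in> fst T. \<bar>Im (ip l (snd T f) f)\<bar> / Re (ip l (snd T f) f))"

definition sl_solution ::
  "real \<Rightarrow> (real \<Rightarrow> real) \<Rightarrow> complex \<Rightarrow> complex \<Rightarrow> complex \<Rightarrow> fn \<Rightarrow> bool" where
  "sl_solution l q z a b y \<longleftrightarrow> sl_regular l y \<and>
     (AE x in lebesgue_on {l..}. sl_expr l q y x = z * y x) \<and> y l = a \<and> D1 l y l = b"

text \<open>For a nonnegative minimal operator the Weyl function lives on the complement of the closed
  positive half-axis. Its values elsewhere are irrelevant.\<close>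

definition weyl_function :: "real \<Rightarrow> (real \<Rightarrow> real) \<Rightarrow> (complex \<Rightarrow> complex) \<Rightarrow> bool" where
  "weyl_function l q m \<longleftrightarrow> (\<forall>z. z \<notin> \<real>\<^sub>\<ge>\<^sub>0 \<longrightarrow>
     (\<exists>\<phi>1 \<phi>2. sl_solution l q z 0 1 \<phi>1 \<and> sl_solution l q z (- 1) 0 \<phi>2 \<and>
        L2 l (\<lambda>x. \<phi>2 x + m z * \<phi>1 x)))"

text \<open>An element \<open>F\<close> of the negative space of the rigged triplet is represented by the antilinear
  functional \<open>\<lambda>f. (F, f)\<close> on the positive space; in particular an element \<open>y\<close> of the
  Hilbert space is represented by \<open>\<lambda>f. (y, f)\<close>. Only equality of such functionals on
  the positive space matters.\<close>

type_synonym functional = "fn \<Rightarrow> complex"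

record L_system =
  plus_space :: "fn set"
  plus_ip :: "fn \<Rightarrow> fn \<Rightarrow> complex"
  base_ip :: "fn \<Rightarrow> fn \<Rightarrow> complex"
  main_op :: op_L2
  state_op :: "fn \<Rightarrow> functional"
  channel_op :: "complex \<Rightarrow> functional"

text \<open>The unique \<open>y\<close> in the positive space with \<open>(state_op - z) y = F\<close>.\<close>

definition state_resolvent :: "L_system \<Rightarrow> complex \<Rightarrow> functional \<Rightarrow> fn" where
  "state_resolvent \<Theta> z F = (THE y. y \<in> plus_space \<Theta> \<and>
     (\<forall>f \<in> plus_space \<Theta>. state_op \<Theta> y f - z * base_ip \<Theta> y f = F f))"

text \<open>The adjoint of \<open>K\<close> maps the positive space to the scalars and is determined by
  \<open>(K c, y) = c * cnj (K\<^sup>* y)\<close>; take \<open>c = 1\<close>.\<close>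

definition channel_adj :: "L_system \<Rightarrow> fn \<Rightarrow> complex" where
  "channel_adj \<Theta> y = cnj (channel_op \<Theta> 1 y)"

definition transfer_function :: "L_system \<Rightarrow> complex \<Rightarrow> complex" where
  "transfer_function \<Theta> z =
     1 - 2 * \<i> * channel_adj \<Theta> (state_resolvent \<Theta> z (channel_op \<Theta> 1))"

text \<open>The entropy is infinite when the transfer function vanishes at \<open>- \<i>\<close>.\<close>

definition c_entropy :: "L_system \<Rightarrow> ereal" where
  "c_entropy \<Theta> = (if transfer_function \<Theta> (- \<i>) = 0 then \<infinity>
                  else ereal (- ln (cmod (transfer_function \<Theta> (- \<i>)))))"

datatype ext_real = Fin real | Infty

definition delta :: "real \<Rightarrow> functional" where
  "delta l f = cnj (f l)"

definition delta' :: "real \<Rightarrow> functional" where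
  "delta' l f = - cnj (D1 l f l)"

text \<open>The value at \<open>Infty\<close> is the limit as \<open>\<mu> \<rightarrow> + \<infinity>\<close>.\<close>

fun schr_state_op ::
  "real \<Rightarrow> (real \<Rightarrow> real) \<Rightarrow> ext_real \<Rightarrow> complex \<Rightarrow> fn \<Rightarrow> functional" where
  "schr_state_op l q (Fin \<mu>) h y f = ip l (sl_expr l q y) f
     - 1 / (of_real \<mu> - h) * (D1 l y l - h * y l) * (of_real \<mu> * delta l f + delta' l f)"
| "schr_state_op l q Infty h y f = ip l (sl_expr l q y) f - (D1 l y l - h * y l) * delta l f"

fun schr_channel_vec :: "real \<Rightarrow> ext_real \<Rightarrow> complex \<Rightarrow> functional" where
  "schr_channel_vec l (Fin \<mu>) h f = of_real (sqrt (Im h) / cmod (of_real \<mu> - h))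
     * (of_real \<mu> * delta l f + delta' l f)"
| "schr_channel_vec l Infty h f = of_real (sqrt (Im h)) * delta l f"

definition schr_L_system ::
  "real \<Rightarrow> (real \<Rightarrow> real) \<Rightarrow> ext_real \<Rightarrow> complex \<Rightarrow> L_system" where
  "schr_L_system l q \<mu> h =
     \<lparr> plus_space = Dstar l q,
       plus_ip = (\<lambda>y z. ip l y z + ip l (sl_expr l q y) (sl_expr l q z)),
       base_ip = ip l,
       main_op = T_op l q h,
       state_op = schr_state_op l q \<mu> h,
       channel_op = (\<lambda>c f. c * schr_channel_vec l \<mu> h f) \<rparr>"

definition sectorial_params :: "real \<Rightarrow> (real \<Rightarrow> real) \<Rightarrow> real \<Rightarrow> (ext_real \<times> complex) set" where
  "sectorial_params l q \<beta> =
     {(\<mu>, h). Im h > 0 \<and> sectorial l (main_op (schr_L_system l q \<mu> h)) \<beta>}"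

definition has_max_finite_entropy ::
  "real \<Rightarrow> (real \<Rightarrow> real) \<Rightarrow> real \<Rightarrow> ext_real \<Rightarrow> complex \<Rightarrow> bool" where
  "has_max_finite_entropy l q \<beta> \<mu> h \<longleftrightarrow>
     (\<mu>, h) \<in> sectorial_params l q \<beta> \<and>
     c_entropy (schr_L_system l q \<mu> h) < \<infinity> \<and>
     (\<forall>(\<mu>', h') \<in> sectorial_params l q \<beta>.
        c_entropy (schr_L_system l q \<mu>' h') \<le> c_entropy (schr_L_system l q \<mu> h))"

end

theory Submission
  imports Defs
begin

text \<open>Everything is governed by the energy form \<open>E(y) = (l(y), y) - y'(l) cnj y(l)\<close> on the maximal domain. Integration by
  parts makes it \<open>\<integral> \<bar>y'\<bar>\<^sup>2 + q \<bar>y\<bar>\<^sup>2\<close> formally, and on the domain of \<open>T\<^sub>h\<close> one has \<open>(T\<^sub>h y, y) = E(y) + h \<bar>y(l)\<bar>\<^sup>2\<close>.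

  The form is real because the minimal operator is nonnegative, hence symmetric: any \<open>y\<close> in the maximal domain agrees
  far away with an element of the minimal domain, so there is no boundary term at infinity. To change \<open>y\<close> near
  the endpoint only, solutions of \<open>l(y) = - y\<close> are multiplied with cut-off functions; their existence is contained in that of
  the Weyl function. Such products supported in a layer of width \<open>1 / k\<close> change \<open>y'(l)\<close> at a cost in energy that vanishes
  as \<open>k\<close> grows.

  The number \<open>m\<close> is the greatest lower bound of \<open>E(y) / \<bar>y(l)\<bar>\<^sup>2\<close>. It is a lower bound since, for \<open>t < 0\<close>, the form
  \<open>E - t \<parallel>\<cdot>\<parallel>\<^sup>2\<close> splits orthogonally along the Weyl solution at \<open>t\<close>, on which it equals \<open>m_inf t\<close>, and functions
  vanishing at the endpoint, on which it is nonnegative (\<open>form_lower_bound\<close>). It is attained in the limit, even inside the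
  domain of each \<open>T\<^sub>h\<close>, by Weyl solutions corrected by a thin boundary layer (\<open>form_lower_bound_sharp\<close>). Therefore \<open>T\<^sub>h\<close> is
  sectorial with exact angle \<open>\<beta>\<close> if and only if \<open>h + m = r exp (\<i> \<beta>)\<close> with \<open>r > 0\<close> (\<open>sectorial_iff\<close>).

  The resolvent of the state-space operator at \<open>- \<i>\<close> sends the channel vector to a multiple of the Weyl solution, which gives
  \<open>\<bar>W(- \<i>)\<bar> = \<bar>m_inf \<i> + h\<bar> / \<bar>m_inf \<i> + cnj h\<bar>\<close> independently of \<open>\<mu>\<close> (\<open>cmod_transfer_function\<close>). Along the ray the square
  of this modulus is \<open>(D + r\<^sup>2 + 2 r P) / (D + r\<^sup>2 + 2 r Q)\<close> with \<open>P < Q\<close>, where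
  \<open>P\<close> and \<open>Q\<close> are \<open>(A - m) cos \<beta> \<mp> B sin \<beta>\<close>. It is smallest exactly where \<open>r + D / r\<close> is, at \<open>r = sqrt D\<close>.
  The numerator never vanishes because \<open>A \<ge> m\<close>, which is the lower bound for \<open>E\<close> tested on the Weyl solution at \<open>\<i>\<close>.\<close>

section \<open>Densities of absolutely continuous functions\<close>

text \<open>The half-lines \<open>{..x}\<close> are an intersection-stable generator of the Borel sets, so by Dynkin's argument the
  integral vanishes over every Borel set.\<close>

lemma borel_integral_zero_imp_AE_zero:
  fixes f :: "real \<Rightarrow> complex"
  assumes f: "integrable lborel f"
    and zero: "\<And>x. (LINT t:{..x}|lborel. f t) = 0"
  shows "AE t in lborel. f t = 0"
proof (rule sigma_finite_measure.density_zero[OF lborel.sigma_finite_measure_axioms f])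
  fix A :: "real set" assume A: "A \<in> sets lborel"
  have int: "set_integrable lborel S f" if "S \<in> sets borel" for S
    using that f unfolding set_integrable_def by (intro integrable_mult_indicator) auto
  have total: "integral\<^sup>L lborel f = 0"
    using LIMSEQ_unique[OF filterlim_compose[OF tendsto_integral_at_top[OF _ f] filterlim_real_sequentially]
      , of 0] zero unfolding set_lebesgue_integral_def by (simp add: comp_def)
  have gen: "sets borel = sigma_sets UNIV (range (atMost :: real \<Rightarrow> _))"
    by (subst borel_eq_atMost) (rule sets_measure_of, auto)
  have stable: "Int_stable (range (atMost :: real \<Rightarrow> _))"
    by (auto simp: Int_stable_def)
  have subs: "range (atMost :: real \<Rightarrow> _) \<subseteq> Pow UNIV" by auto
  from A gen have "A \<in> sigma_sets UNIV (range (atMost :: real \<Rightarrow> _))" by simp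
  with stable subs show "(LINT t:A|lborel. f t) = 0"
  proof (induction rule: sigma_sets_induct_disjoint)
    case (compl A)
    then have A: "A \<in> sets borel" using gen by simp
    have "(LINT t:(A \<union> (UNIV - A))|lborel. f t) = (LINT t:A|lborel. f t) + (LINT t:(UNIV - A)|lborel. f t)"
      using A by (intro set_integral_Un int) auto
    moreover have "A \<union> (UNIV - A) = UNIV" by auto
    ultimately show ?case using compl total by (simp add: set_lebesgue_integral_def)
  next
    case (union A)
    have "(LINT t:(\<Union>i. A i)|lborel. f t) = (\<Sum>i. LINT t:A i|lborel. f t)"
    proof (rule lebesgue_integral_countable_add)
      show "\<And>i. A i \<in> sets lborel" using union(2) gen by auto
      show "set_integrable lborel (\<Union> (range A)) f" 
        using union(2) unfolding gen[symmetric] by (intro int) auto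
      show "\<And>i j. i \<noteq> j \<Longrightarrow> A i \<inter> A j = {}" using union(1) by (auto simp: disjoint_family_on_def)
    qed
    then show ?case using union by simp
  qed (use zero in \<open>auto simp: set_lebesgue_integral_def\<close>)
qed

text \<open>Passing to a Borel representative on each bounded interval reduces the claim to the previous lemma.\<close>

lemma loc_summable_integral_zero_imp_AE_zero:
  fixes g :: fn
  assumes g: "loc_summable l g" and zero: "\<And>x. x \<ge> l \<Longrightarrow> integral {l..x} g = 0"
  shows "AE x in lebesgue_on {l..}. g x = 0"
proof -
  have loc: "AE x in lebesgue. x \<in> {l..l + real n} \<longrightarrow> g x = 0" for n
  proof -
    define b f where "b = l + real n" and "f = (\<lambda>x. indicator {l..b} x *\<^sub>R g x)"
    have f: "integrable lebesgue f"
      using g unfolding loc_summable_def set_integrable_def f_def by auto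
    have "(\<lambda>x. Re (f x)) \<in> borel_measurable lebesgue" "(\<lambda>x. Im (f x)) \<in> borel_measurable lebesgue"
      using f by auto
    then obtain u v where uv: "u \<in> borel_measurable lborel" "AE x in lborel. Re (f x) = u x"
        "v \<in> borel_measurable lborel" "AE x in lborel. Im (f x) = v x"
      using completion_ex_borel_measurable_real by metis
    define f' where "f' = (\<lambda>x. Complex (u x) (v x))"
    have "f' = (\<lambda>x. of_real (u x) + \<i> * of_real (v x))"
      by (auto simp: f'_def complex_eq_iff)
    then have m': "f' \<in> borel_measurable lborel"
      using uv(1,3) by (simp) measurable
    have f': "f' \<in> borel_measurable lborel" "AE x in lborel. f x = f' x"
      using m' uv(2,4) by (auto elim!: eventually_elim2 simp: f'_def complex_eq_iff)
    have eq: "AE x in lebesgue. f x = f' x" using f'(2) by (rule AE_completion)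
    have int': "integrable lborel f'"
    proof -
      have "integrable lebesgue f'"
        using f by (rule integrable_cong_AE_imp) (use f' eq in \<open>auto intro: measurable_completion\<close>)
      then show ?thesis using integrable_completion[OF f'(1)] by simp
    qed
    have "AE x in lborel. f' x = 0"
    proof (rule borel_integral_zero_imp_AE_zero[OF int'])
      fix x
      have "(LINT t:{..x}|lborel. f' t) = (LINT t|lebesgue. indicator {..x} t *\<^sub>R f' t)"
        unfolding set_lebesgue_integral_def using f'(1) by (subst integral_completion) auto
      also have "\<dots> = (LINT t|lebesgue. indicator {..x} t *\<^sub>R f t)"
      proof (rule integral_cong_AE)
        have ms: "f \<in> borel_measurable lebesgue" "f' \<in> borel_measurable lebesgue"
          using f f'(1) by (auto intro: measurable_completion)
        show "(\<lambda>t. indicat_real {..x} t *\<^sub>R f' t) \<in> borel_measurable lebesgue"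
          "(\<lambda>t. indicat_real {..x} t *\<^sub>R f t) \<in> borel_measurable lebesgue"
          using ms by (auto intro!: borel_measurable_scaleR borel_measurable_indicator)
        show "AE t in lebesgue. indicat_real {..x} t *\<^sub>R f' t = indicat_real {..x} t *\<^sub>R f t"
          using eq by eventually_elim simp
      qed
      also have "\<dots> = (LINT t:{l..min x b}|lebesgue. g t)"
        unfolding set_lebesgue_integral_def f_def
        by (intro Bochner_Integration.integral_cong) (auto split: split_indicator)
      also have "\<dots> = integral {l..min x b} g"
        using g unfolding loc_summable_def by (intro set_lebesgue_integral_eq_integral) auto
      also have "\<dots> = 0"
      proof (cases "l \<le> min x b")
        case True
        then show ?thesis by (rule zero)
      next
        case False
        then have "{l..min x b} = {}" by auto
        then show ?thesis by (simp only: Henstock_Kurzweil_Integration.integral_empty)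
      qed
      finally show "(LINT t:{..x}|lborel. f' t) = 0" .
    qed
    then have "AE x in lebesgue. f' x = 0" by (rule AE_completion)
    with eq show ?thesis by eventually_elim (auto simp: f_def b_def)
  qed
  have "AE x in lebesgue. \<forall>n. x \<in> {l..l + real n} \<longrightarrow> g x = 0"
    using loc by (subst AE_all_countable) auto
  then have "AE x in lebesgue. x \<in> {l..} \<longrightarrow> g x = 0"
  proof eventually_elim
    case (elim x)
    obtain n where "x - l \<le> real n" using real_arch_simple by blast
    then show ?case using elim[rule_format, of n] by auto
  qed
  then show ?thesis by (subst AE_restrict_space_iff) auto
qed

lemma loc_summableD:
  assumes "loc_summable l g"
  shows "g absolutely_integrable_on {l..b}" "g integrable_on {l..b}"
  using assms unfolding loc_summable_def by (auto intro: set_lebesgue_integral_eq_integral(1))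

lemma ac_densityD:
  assumes "ac_density l f g"
  shows "loc_summable l g" "x \<ge> l \<Longrightarrow> f x = f l + integral {l..x} g"
  using assms unfolding ac_density_def by blast+

text \<open>Uniqueness makes the choice of a density in the differential expression harmless: whatever density
  of the derivative is exhibited, the expression is known almost everywhere.\<close>

lemma ac_density_unique:
  assumes "ac_density l f g" "ac_density l f g'"
  shows "AE x in lebesgue_on {l..}. g x = g' x"
proof -
  have i: "g absolutely_integrable_on {l..x}" "g' absolutely_integrable_on {l..x}" for x
    using assms ac_densityD(1) loc_summableD(1) by blast+
  have "AE x in lebesgue_on {l..}. g x - g' x = 0"
  proof (rule loc_summable_integral_zero_imp_AE_zero)
    show "loc_summable l (\<lambda>x. g x - g' x)"
      using i by (auto simp: loc_summable_def)
    fix x assume "x \<ge> l"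
    then have "f x = f l + integral {l..x} g" "f x = f l + integral {l..x} g'"
      using assms ac_densityD(2) by blast+
    then have "integral {l..x} g = integral {l..x} g'" by simp
    then show "integral {l..x} (\<lambda>x. g x - g' x) = 0"
      using i[of x] by (subst Henstock_Kurzweil_Integration.integral_diff)
        (auto intro: set_lebesgue_integral_eq_integral(1))
  qed
  then show ?thesis by auto
qed

lemma ac_density_cong:
  assumes "\<And>x. x \<ge> l \<Longrightarrow> f x = f' x"
  shows "ac_density l f g \<longleftrightarrow> ac_density l f' g"
proof -
  have "ac_density l f' g" if "ac_density l f g" "\<And>x. x \<ge> l \<Longrightarrow> f x = f' x" for f f'
    unfolding ac_density_def
  proof (intro conjI allI impI ac_densityD(1)[OF that(1)])
    fix x assume "l \<le> x"
    then show "f' x = f' l + integral {l..x} g"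
      using ac_densityD(2)[OF that(1), of x] that(2)[of x] that(2)[of l] by simp
  qed
  from this[of f f'] this[of f' f] assms show ?thesis by auto
qed

lemma ac_density_linear:
  assumes "ac_density l f g" "ac_density l f' g'"
  shows "ac_density l (\<lambda>x. a * f x + b * f' x) (\<lambda>x. a * g x + b * g' x)"
proof -
  have i: "g absolutely_integrable_on {l..x}" "g' absolutely_integrable_on {l..x}" for x
    using assms ac_densityD(1) loc_summableD(1) by blast+
  have "integral {l..x} (\<lambda>x. a * g x + b * g' x) = a * integral {l..x} g + b * integral {l..x} g'" for x
    using i[of x]
    by (subst Henstock_Kurzweil_Integration.integral_add)
      (auto intro: set_lebesgue_integral_eq_integral(1))
  note eq = this
  show ?thesis
    unfolding ac_density_def eq
  proof (intro conjI allI impI)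
    show "loc_summable l (\<lambda>x. a * g x + b * g' x)"
      using i by (auto simp: loc_summable_def)
    fix x assume "l \<le> x"
    then have "f x = f l + integral {l..x} g" "f' x = f' l + integral {l..x} g'"
      using assms ac_densityD(2) by blast+
    then show "a * f x + b * f' x = a * f l + b * f' l + (a * integral {l..x} g + b * integral {l..x} g')"
      by algebra
  qed
qed

lemma ac_density_imp_continuous:
  assumes "ac_density l f g"
  shows "continuous_on {l..} f"
proof -
  have "continuous_on {l..b} f" for b
  proof -
    have "g integrable_on {l..b}"
      using assms ac_densityD(1) loc_summableD(2) by blast
    then have "continuous_on {l..b} (\<lambda>x. f l + integral {l..x} g)"
      by (intro continuous_intros indefinite_integral_continuous_1)
    moreover have "f x = f l + integral {l..x} g" if "x \<in> {l..b}" for x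
      using that by (intro ac_densityD(2)[OF assms]) auto
    ultimately show ?thesis
      by (subst continuous_on_cong[OF refl]) assumption+
  qed
  then have c: "continuous (at x within {l..b}) f" if "x \<in> {l..b}" for x b
    using that by (auto simp: continuous_on_eq_continuous_within)
  show ?thesis
    unfolding continuous_on_eq_continuous_within
  proof
    fix x assume x: "x \<in> {l..}"
    have "at x within {l..} = at x within {l..x+1}"
      by (rule at_within_nhd[where S = "{..<x+1}"]) auto
    then show "continuous (at x within {l..}) f" using c[of x "x+1"] x by simp
  qed
qed

lemma ac_density_of_C1:
  assumes "\<And>x. x \<ge> l \<Longrightarrow> (G has_vector_derivative g x) (at x within {l..})"
    and "continuous_on {l..} g"
  shows "ac_density l G g"
  unfolding ac_density_def loc_summable_def
proof (intro conjI allI impI)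
  fix b
  have "continuous_on {l..b} g" using assms(2) by (rule continuous_on_subset) auto
  then show "g absolutely_integrable_on {l..b}"
    by (metis absolutely_integrable_continuous box_real(2))
next
  fix x assume "x \<ge> l"
  have "(g has_integral (G x - G l)) {l..x}"
    using assms \<open>x \<ge> l\<close>
    by (intro fundamental_theorem_of_calculus) (auto intro!: has_vector_derivative_within_subset[OF assms(1)])
  then show "G x = G l + integral {l..x} g" by (simp add: integral_unique)
qed

lemma loc_summable_mult_continuous:
  fixes f G :: fn
  assumes "loc_summable l f" "continuous_on {l..} G"
  shows "loc_summable l (\<lambda>x. f x * G x)"
  unfolding loc_summable_def
proof
  fix b
  have c: "continuous_on {l..b} G" using assms(2) by (rule continuous_on_subset) auto
  have "(\<lambda>x. (*) (G x) (f x)) absolutely_integrable_on {l..b}"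
  proof (rule absolutely_integrable_bounded_measurable_product[where h = "(*)"])
    show "bilinear ((*) :: complex \<Rightarrow> _)" by (rule bilinear_times)
    show "G \<in> borel_measurable (lebesgue_on {l..b})"
      using c by (rule continuous_imp_measurable_on_sets_lebesgue) auto
    show "bounded (G ` {l..b})" using c by (intro compact_imp_bounded compact_continuous_image) auto
  qed (use assms in \<open>auto simp: loc_summable_def\<close>)
  then show "(\<lambda>x. f x * G x) absolutely_integrable_on {l..b}" by (simp add: mult.commute)
qed

lemma indefinite_integral_diff:
  fixes f :: "real \<Rightarrow> 'b::euclidean_space"
  assumes "loc_summable l f" "l \<le> x" "x \<le> y"
  shows "(f has_integral (integral {l..y} f - integral {l..x} f)) {x..y}"
proof -
  have i: "f integrable_on {l..y}" using loc_summableD(2)[OF assms(1)] .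
  have "integral {l..x} f + integral {x..y} f = integral {l..y} f"
    using assms i by (intro Henstock_Kurzweil_Integration.integral_combine) auto
  then have "integral {x..y} f = integral {l..y} f - integral {l..x} f" by (simp add: algebra_simps)
  moreover have "f integrable_on {x..y}" using assms by (intro integrable_on_subinterval[OF i]) auto
  ultimately show ?thesis by (metis integrable_integral)
qed

lemma ac_density_integral:
  assumes "ac_density l f g" "l \<le> x" "x \<le> y"
  shows "(g has_integral (f y - f x)) {x..y}"
proof -
  have e: "f x = f l + integral {l..x} g" "f y = f l + integral {l..y} g"
    using assms by (auto intro: ac_densityD(2))
  have "f y - f x = integral {l..y} g - integral {l..x} g" unfolding e by simp
  then show ?thesis
    using indefinite_integral_diff[OF ac_densityD(1)[OF assms(1)] assms(2,3)] by (simp only:)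
qed

lemma loc_summable_norm: "loc_summable l f \<Longrightarrow> loc_summable l (\<lambda>x. norm (f x))"
  by (auto simp: loc_summable_def intro: set_integrable_norm)

lemma continuous_imp_loc_summable:
  fixes f :: "real \<Rightarrow> 'b::euclidean_space"
  assumes "continuous_on {l..} f"
  shows "loc_summable l f"
  unfolding loc_summable_def
proof
  fix b
  have "continuous_on {l..b} f" using assms by (rule continuous_on_subset) auto
  then show "f absolutely_integrable_on {l..b}"
    by (metis absolutely_integrable_continuous box_real(2))
qed

lemma loc_summable_add: "loc_summable l f \<Longrightarrow> loc_summable l g \<Longrightarrow> loc_summable l (\<lambda>x. f x + g x)"
  by (auto simp: loc_summable_def)

text \<open>The bound is \<open>o(y - x)\<close> because \<open>N\<close> is continuous, so the derivative of \<open>H\<close> exists and is zero everywhere.\<close>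

lemma zero_derivative_of_quadratic_bound:
  fixes H :: fn and N :: "real \<Rightarrow> real"
  assumes N: "continuous_on {l..b} N" and "l \<le> b"
    and H: "\<And>x y. l \<le> x \<Longrightarrow> x \<le> y \<Longrightarrow> y \<le> b \<Longrightarrow> norm (H y - H x) \<le> K * (y - x) * (N y - N x)"
  shows "H b = H l"
proof -
  have "(H has_derivative (\<lambda>_. 0)) (at x within {l..b})" if x: "x \<in> {l..b}" for x
  proof -
    have lim: "((\<lambda>y. \<bar>K\<bar> * \<bar>N y - N x\<bar>) \<longlongrightarrow> 0) (at x within {l..b})"
    proof -
      have "(N \<longlongrightarrow> N x) (at x within {l..b})" using N x by (auto simp: continuous_on_def)
      then have "((\<lambda>y. \<bar>K\<bar> * \<bar>N y - N x\<bar>) \<longlongrightarrow> \<bar>K\<bar> * \<bar>N x - N x\<bar>) (at x within {l..b})"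
        by (intro tendsto_intros)
      then show ?thesis by simp
    qed
    have bound: "norm (H y - H x) \<le> \<bar>K\<bar> * \<bar>N y - N x\<bar> * \<bar>y - x\<bar>" if "y \<in> {l..b}" for y
    proof (cases "x \<le> y")
      case True
      then have "norm (H y - H x) \<le> K * (y - x) * (N y - N x)" using H x that by auto
      also have "\<dots> \<le> \<bar>K * (y - x) * (N y - N x)\<bar>" by simp
      finally show ?thesis by (simp add: abs_mult mult_ac)
    next
      case False
      then have "norm (H x - H y) \<le> K * (x - y) * (N x - N y)" using H x that by auto
      also have "\<dots> \<le> \<bar>K * (x - y) * (N x - N y)\<bar>" by simp
      finally show ?thesis by (simp add: abs_mult mult_ac abs_minus_commute norm_minus_commute)
    qed
    have "((\<lambda>y. norm (H y - H x) / \<bar>y - x\<bar>) \<longlongrightarrow> 0) (at x within {l..b})"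
    proof (rule Lim_null_comparison[OF _ lim])
      show "\<forall>\<^sub>F y in at x within {l..b}. norm (norm (H y - H x) / \<bar>y - x\<bar>) \<le> \<bar>K\<bar> * \<bar>N y - N x\<bar>"
        unfolding eventually_at_filter
      proof (intro always_eventually allI impI)
        fix y assume "y \<noteq> x" "y \<in> {l..b}"
        then show "norm (norm (H y - H x) / \<bar>y - x\<bar>) \<le> \<bar>K\<bar> * \<bar>N y - N x\<bar>"
          using bound[of y] by (simp add: divide_le_eq)
      qed
    qed
    then show ?thesis
      by (auto simp: has_derivative_within tendsto_norm_zero_iff[symmetric, of "\<lambda>y. _ y /\<^sub>R _ y"]
          divide_inverse mult.commute)
  qed
  then have "\<exists>c. \<forall>x\<in>{l..b}. H x = c"
    by (intro has_derivative_zero_constant) auto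
  then show ?thesis using \<open>l \<le> b\<close> by auto
qed

text \<open>The product rule for an absolutely continuous \<open>F\<close> and a continuously differentiable \<open>G\<close>. The defect
  \<open>H x = F x * G x - \<integral> (f * G + F * g)\<close> changes between \<open>x\<close> and \<open>y\<close> by
  \<open>\<integral> f t * (G x - G t) + (F y - F t) * g t\<close>. Each summand is a product of two small factors, so the change is
  at most a constant times \<open>(y - x) * \<integral> \<bar>f\<bar>\<close>, and therefore \<open>H\<close> has derivative zero.\<close>

lemma ac_density_mult:
  assumes F: "ac_density l F f"
    and G: "\<And>x. x \<ge> l \<Longrightarrow> (G has_vector_derivative g x) (at x within {l..})"
    and g: "continuous_on {l..} g"
  shows "ac_density l (\<lambda>x. F x * G x) (\<lambda>x. f x * G x + F x * g x)"
proof -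
  have Gac: "ac_density l G g" using G g by (rule ac_density_of_C1)
  have cF: "continuous_on {l..} F" and cG: "continuous_on {l..} G"
    using F Gac ac_density_imp_continuous by blast+
  have sf: "loc_summable l f" using F ac_densityD by blast
  have sfG: "loc_summable l (\<lambda>x. f x * G x)" using sf cG by (rule loc_summable_mult_continuous)
  have sFg: "loc_summable l (\<lambda>x. F x * g x)"
    using cF g by (intro continuous_imp_loc_summable continuous_intros)
  have s: "loc_summable l (\<lambda>x. f x * G x + F x * g x)" using sfG sFg by (rule loc_summable_add)
  have "F b * G b = F l * G l + integral {l..b} (\<lambda>x. f x * G x + F x * g x)" if "l \<le> b" for b
  proof -
    define H where "H x = F x * G x - integral {l..x} (\<lambda>x. f x * G x + F x * g x)" for x
    define N where "N x = integral {l..x} (\<lambda>x. norm (f x))" for x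
    have "compact (g ` {l..b})" using g by (intro compact_continuous_image continuous_on_subset[OF g]) auto
    then obtain M where M: "M > 0" "\<And>x. x \<in> {l..b} \<Longrightarrow> norm (g x) \<le> M"
      by (metis compact_imp_bounded bounded_pos imageI)
    have "norm (H y - H x) \<le> (2 * M) * (y - x) * (N y - N x)" if xy: "l \<le> x" "x \<le> y" "y \<le> b" for x y
    proof -
      have Nxy: "((\<lambda>x. norm (f x)) has_integral (N v - N u)) {u..v}" if "l \<le> u" "u \<le> v" for u v
        unfolding N_def by (rule indefinite_integral_diff[OF loc_summable_norm[OF sf] that])
      have Gt: "norm (G x - G t) \<le> M * (y - x)" if "t \<in> {x..y}" for t
      proof -
        have "(g has_integral (G t - G x)) {x..t}" using ac_density_integral[OF Gac] xy that by auto
        then have "norm (G t - G x) \<le> M * (t - x)"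
          using has_integral_bound_real[of M "{}" g "G t - G x" x t] M xy that by auto
        also have "\<dots> \<le> M * (y - x)" using M that by simp
        finally show ?thesis by (simp add: norm_minus_commute)
      qed
      have Ft: "norm (F y - F t) \<le> N y - N x" if "t \<in> {x..y}" for t
      proof -
        have 1: "(f has_integral (F y - F t)) {t..y}" using ac_density_integral[OF F] xy that by auto
        have 2: "((\<lambda>x. norm (f x)) has_integral (N y - N t)) {t..y}" using Nxy xy that by auto
        have "norm (F y - F t) \<le> N y - N t"
          using integral_norm_bound_integral[of f "{t..y}" "\<lambda>x. norm (f x)"] 1 2
          by (auto simp: has_integral_iff)
        also have "\<dots> \<le> N y - N x"
          using has_integral_nonneg[OF Nxy[of x t]] xy that by auto
        finally show ?thesis .
      qed
      have I1: "((\<lambda>t. f t * G x + F y * g t) has_integral ((F y - F x) * G x + F y * (G y - G x))) {x..y}"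
        using xy by (intro has_integral_add has_integral_mult_left has_integral_mult_right
            ac_density_integral[OF F] ac_density_integral[OF Gac])
      have "((\<lambda>x. f x * G x + F x * g x) has_integral
          (integral {l..y} (\<lambda>x. f x * G x + F x * g x) - integral {l..x} (\<lambda>x. f x * G x + F x * g x))) {x..y}"
        by (rule ac_density_integral[OF _ xy(1,2)]) (auto simp: ac_density_def s)
      from has_integral_diff[OF I1 this]
      have I2: "((\<lambda>t. f t * (G x - G t) + (F y - F t) * g t) has_integral (H y - H x)) {x..y}"
        by (simp add: H_def algebra_simps)
      have I3: "((\<lambda>t. norm (f t) * (M * (y - x)) + (N y - N x) * M) has_integral
          ((N y - N x) * (M * (y - x)) + (y - x) *\<^sub>R ((N y - N x) * M))) {x..y}"
        using xy has_integral_const_real[of "(N y - N x) * M" x y]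
        by (intro has_integral_add has_integral_mult_left Nxy) auto
      have "norm (H y - H x) \<le> (N y - N x) * (M * (y - x)) + (y - x) *\<^sub>R ((N y - N x) * M)"
      proof -
        have "norm (f t * (G x - G t) + (F y - F t) * g t) \<le> norm (f t) * (M * (y - x)) + (N y - N x) * M"
          if t: "t \<in> {x..y}" for t
        proof -
          have "norm (f t * (G x - G t)) \<le> norm (f t) * (M * (y - x))"
            using Gt[OF t] by (simp add: norm_mult mult_left_mono)
          moreover have "norm ((F y - F t) * g t) \<le> (N y - N x) * M"
            using Ft[OF t] M t xy by (auto simp: norm_mult intro!: mult_mono intro: order_trans[OF norm_ge_zero])
          ultimately show ?thesis by (intro norm_triangle_mono)
        qed
        then show ?thesis
          using integral_norm_bound_integral[of "\<lambda>t. f t * (G x - G t) + (F y - F t) * g t" "{x..y}"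
              "\<lambda>t. norm (f t) * (M * (y - x)) + (N y - N x) * M"] I2 I3 by (auto simp: has_integral_iff)
      qed
      then show ?thesis by (simp add: algebra_simps)
    qed
    moreover have "continuous_on {l..b} N"
      unfolding N_def using loc_summableD(2)[OF loc_summable_norm[OF sf]]
      by (intro indefinite_integral_continuous_1)
    ultimately have "H b = H l" using \<open>l \<le> b\<close> by (intro zero_derivative_of_quadratic_bound)
    then show ?thesis by (simp add: H_def algebra_simps)
  qed
  then show ?thesis using s unfolding ac_density_def by blast
qed

section \<open>The differential expression on quasi-regular functions\<close>

text \<open>The predicate carries the derivative and a density of it as explicit parameters, so that both can be
  computed for concrete functions; the choice operators in the definition of the expression are then
  eliminated almost everywhere.\<close>

definition sl_pair :: "real \<Rightarrow> fn \<Rightarrow> fn \<Rightarrow> fn \<Rightarrow> bool" where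
  "sl_pair l y p r \<longleftrightarrow>
     (\<forall>x\<ge>l. (y has_vector_derivative p x) (at x within {l..})) \<and> ac_density l p r"

lemma at_within_half_line_nontrivial: "x \<ge> (l::real) \<Longrightarrow> at x within {l..} \<noteq> bot"
proof -
  assume "l \<le> x"
  then have "at_right x \<le> at x within {l..}" by (intro at_le) auto
  then show ?thesis by (metis le_bot trivial_limit_at_right_real)
qed

lemma D1_eqI:
  assumes "(y has_vector_derivative p) (at x within {l..})" "x \<ge> l"
  shows "D1 l y x = p"
  unfolding D1_def by (rule vector_derivative_within[OF at_within_half_line_nontrivial[OF assms(2)] assms(1)])

lemma sl_pair_continuous:
  assumes "sl_pair l y p r"
  shows "continuous_on {l..} y" "continuous_on {l..} p"
  using assms ac_density_imp_continuous[of l p r]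
  by (auto simp: sl_pair_def continuous_on_eq_continuous_within intro!: has_vector_derivative_continuous)

lemma sl_pair_regular:
  assumes "sl_pair l y p r"
  shows "sl_regular l y" and "x \<ge> l \<Longrightarrow> D1 l y x = p x"
    and "AE x in lebesgue_on {l..}. sl_expr l q y x = - r x + of_real (q x) * y x"
proof -
  show D: "D1 l y x = p x" if "x \<ge> l" for x
    using assms that by (auto simp: sl_pair_def intro: D1_eqI)
  have p: "ac_density l p r" and y: "ac_density l y p"
    using assms sl_pair_continuous[OF assms] by (auto simp: sl_pair_def intro: ac_density_of_C1)
  have p': "ac_density l (D1 l y) r"
    using p ac_density_cong[of l "D1 l y" p r] D by blast
  then have "ac_density l (D1 l y) (ac_deriv l (D1 l y))"
    unfolding ac_deriv_def by (rule someI[of "ac_density l (D1 l y)"])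
  from ac_density_unique[OF this p']
  show "AE x in lebesgue_on {l..}. sl_expr l q y x = - r x + of_real (q x) * y x"
    by eventually_elim (simp add: sl_expr_def)
  show "sl_regular l y"
    using assms y p' unfolding sl_regular_def loc_abs_continuous_def sl_pair_def
    by (metis differentiableI_vector)
qed

lemma sl_regular_pair:
  assumes "sl_regular l y"
  shows "sl_pair l y (D1 l y) (ac_deriv l (D1 l y))"
proof -
  have "(y has_vector_derivative D1 l y x) (at x within {l..})" if "x \<ge> l" for x
    using assms that unfolding sl_regular_def D1_def by (metis vector_derivative_works)
  moreover have "ac_density l (D1 l y) (ac_deriv l (D1 l y))"
    using assms unfolding ac_deriv_def sl_regular_def loc_abs_continuous_def by (metis someI)
  ultimately show ?thesis by (auto simp: sl_pair_def)
qed

lemma sl_pair_linear: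
  assumes "sl_pair l y p r" "sl_pair l y' p' r'"
  shows "sl_pair l (\<lambda>x. a * y x + b * y' x) (\<lambda>x. a * p x + b * p' x) (\<lambda>x. a * r x + b * r' x)"
  using assms unfolding sl_pair_def
  by (auto intro!: ac_density_linear derivative_intros)

lemma sl_pair_cong:
  assumes "sl_pair l y p r" "\<And>x. x \<ge> l \<Longrightarrow> y' x = y x"
  shows "sl_pair l y' p r"
  using assms unfolding sl_pair_def
  by (metis atLeast_iff has_vector_derivative_transform)

section \<open>Square integrable functions\<close>

lemma borel_measurable_lebesgue_on_cong_AE:
  fixes f g :: fn
  assumes "f \<in> borel_measurable (lebesgue_on S)" "AE x in lebesgue_on S. f x = g x" "S \<in> sets lebesgue"
  shows "g \<in> borel_measurable (lebesgue_on S)"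
proof -
  have "(\<lambda>x. indicator S x *\<^sub>R f x) \<in> borel_measurable lebesgue"
    using assms by (subst (asm) borel_measurable_restrict_space_iff) auto
  moreover have "AE x in lebesgue. indicator S x *\<^sub>R f x = indicator S x *\<^sub>R g x"
    using assms(2,3) by (subst (asm) AE_restrict_space_iff) (auto elim!: eventually_mono)
  ultimately have "(\<lambda>x. indicator S x *\<^sub>R g x) \<in> borel_measurable lebesgue"
    by (rule borel_measurable_AE)
  then show ?thesis using assms(3) by (subst borel_measurable_restrict_space_iff) auto
qed

lemma L2_cong_AE:
  assumes "L2 l f" "AE x in lebesgue_on {l..}. f x = g x"
  shows "L2 l g"
proof -
  have g: "g \<in> borel_measurable (lebesgue_on {l..})"
    using assms by (intro borel_measurable_lebesgue_on_cong_AE[of f _ g]) (auto simp: L2_def)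
  moreover have "integrable (lebesgue_on {l..}) (\<lambda>x. (cmod (g x))\<^sup>2)"
    by (rule integrable_cong_AE_imp[of _ "\<lambda>x. (cmod (f x))\<^sup>2"])
      (use assms g in \<open>auto simp: L2_def elim!: eventually_mono\<close>)
  ultimately show ?thesis by (simp add: L2_def)
qed

lemma L2_product_integrable:
  assumes "L2 l f" "L2 l g"
  shows "integrable (lebesgue_on {l..}) (\<lambda>x. f x * cnj (g x))"
proof (rule Bochner_Integration.integrable_bound)
  show "integrable (lebesgue_on {l..}) (\<lambda>x. (cmod (f x))\<^sup>2 + (cmod (g x))\<^sup>2)"
    using assms by (auto simp: L2_def)
  have "g \<in> borel_measurable (lebesgue_on {l..})" using assms by (auto simp: L2_def)
  then have "(\<lambda>x. cnj (g x)) \<in> borel_measurable (lebesgue_on {l..})"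
    by (rule borel_measurable_continuous_on[rotated]) (intro continuous_intros)
  then show "(\<lambda>x. f x * cnj (g x)) \<in> borel_measurable (lebesgue_on {l..})"
    using assms by (auto simp: L2_def)
  have "a * b \<le> a\<^sup>2 + b\<^sup>2" if "a \<ge> 0" "b \<ge> 0" for a b :: real
    using sum_squares_bound[of a b] that mult_nonneg_nonneg[OF that] by linarith
  then show "AE x in lebesgue_on {l..}. norm (f x * cnj (g x)) \<le> norm ((cmod (f x))\<^sup>2 + (cmod (g x))\<^sup>2)"
    by (intro AE_I2) (simp add: norm_mult)
qed

lemma L2_linear:
  assumes "L2 l f" "L2 l g"
  shows "L2 l (\<lambda>x. a * f x + b * g x)"
  unfolding L2_def
proof
  show m: "(\<lambda>x. a * f x + b * g x) \<in> borel_measurable (lebesgue_on {l..})"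
    using assms by (auto simp: L2_def)
  show "integrable (lebesgue_on {l..}) (\<lambda>x. (cmod (a * f x + b * g x))\<^sup>2)"
  proof (rule Bochner_Integration.integrable_bound)
    show "integrable (lebesgue_on {l..}) (\<lambda>x. 2 * (cmod a)\<^sup>2 * (cmod (f x))\<^sup>2 + 2 * (cmod b)\<^sup>2 * (cmod (g x))\<^sup>2)"
      using assms by (auto simp: L2_def)
    show "(\<lambda>x. (cmod (a * f x + b * g x))\<^sup>2) \<in> borel_measurable (lebesgue_on {l..})"
      using m by measurable
    have "(cmod (u + v))\<^sup>2 \<le> 2 * (cmod u)\<^sup>2 + 2 * (cmod v)\<^sup>2" for u v
    proof -
      have "(cmod (u + v))\<^sup>2 \<le> (cmod u + cmod v)\<^sup>2" by (intro power_mono norm_triangle_ineq) auto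
      then show ?thesis using sum_squares_bound[of "cmod u" "cmod v"] by (simp add: power2_sum)
    qed
    from this[of "a * f _" "b * g _"]
    show "AE x in lebesgue_on {l..}. norm ((cmod (a * f x + b * g x))\<^sup>2)
        \<le> norm (2 * (cmod a)\<^sup>2 * (cmod (f x))\<^sup>2 + 2 * (cmod b)\<^sup>2 * (cmod (g x))\<^sup>2)"
      by (intro AE_I2) (simp add: norm_mult power_mult_distrib mult_ac)
  qed
qed

lemma ip_linear_left:
  assumes "L2 l f" "L2 l g" "L2 l h"
  shows "ip l (\<lambda>x. a * f x + b * g x) h = a * ip l f h + b * ip l g h"
  using L2_product_integrable[OF assms(1,3)] L2_product_integrable[OF assms(2,3)]
  by (simp add: ip_def algebra_simps)

lemma ip_cnj: "ip l g f = cnj (ip l f g)"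
  unfolding ip_def by (simp flip: Bochner_Integration.integral_cnj add: mult.commute)

lemma ip_linear_right:
  assumes "L2 l f" "L2 l g" "L2 l h"
  shows "ip l h (\<lambda>x. a * f x + b * g x) = cnj a * ip l h f + cnj b * ip l h g"
  by (subst (1 2 3) ip_cnj) (simp add: ip_linear_left[OF assms])

lemma ip_cong_AE_left:
  assumes "L2 l f" "AE x in lebesgue_on {l..}. f x = g x" "L2 l h"
  shows "ip l f h = ip l g h"
  unfolding ip_def
  using L2_product_integrable[OF assms(1,3)] L2_product_integrable[OF L2_cong_AE[OF assms(1,2)] assms(3)] assms(2)
  by (intro integral_cong_AE) (auto elim!: eventually_mono)

lemma ip_self_real: "ip l f f = of_real (Re (ip l f f))"
  using ip_cnj[of l f f] by (metis Reals_cnj_iff of_real_Re)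

lemma ip_self_eq: "Re (ip l f f) = (LINT x|lebesgue_on {l..}. (cmod (f x))\<^sup>2)"
proof -
  have "ip l f f = (LINT x|lebesgue_on {l..}. complex_of_real ((cmod (f x))\<^sup>2))"
    unfolding ip_def by (simp only: complex_norm_square)
  then show ?thesis by (simp only: integral_complex_of_real Re_complex_of_real)
qed

lemma ip_self_nonneg: "Re (ip l f f) \<ge> 0"
  unfolding ip_self_eq by (intro Bochner_Integration.integral_nonneg) auto

lemma ip_self_eq_0:
  assumes "L2 l f" "Re (ip l f f) = 0"
  shows "AE x in lebesgue_on {l..}. f x = 0"
  using assms unfolding ip_self_eq L2_def
  by (subst (asm) integral_nonneg_eq_0_iff_AE) auto

lemma AE_zero_continuous_imp_zero:
  fixes f :: fn
  assumes "AE x in lebesgue_on {l..}. f x = 0" "continuous_on {l..} f" "x \<ge> l"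
  shows "f x = 0"
proof (rule ccontr)
  assume nz: "f x \<noteq> 0"
  have "\<exists>d>0. \<forall>t\<in>{l..}. dist t x < d \<longrightarrow> dist (f t) (f x) < cmod (f x)"
    using assms(2,3) nz unfolding continuous_on_iff by (metis atLeast_iff zero_less_norm_iff)
  then obtain d where d: "d > 0" "\<And>t. t \<ge> l \<Longrightarrow> dist t x < d \<Longrightarrow> dist (f t) (f x) < cmod (f x)"
    by auto
  have nzt: "f t \<noteq> 0" if "t \<in> {x<..<x+d}" for t
  proof
    assume "f t = 0"
    then show False using d(2)[of t] that assms(3) by (auto simp: dist_norm)
  qed
  have "AE t in lebesgue. t \<in> {l..} \<longrightarrow> f t = 0"
    using assms(1) by (subst (asm) AE_restrict_space_iff) auto
  then have "AE t in lebesgue. t \<notin> {x<..<x+d}"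
    by eventually_elim (use nzt assms(3) in auto)
  then have "{x<..<x+d} \<in> null_sets lebesgue"
    by (subst AE_iff_null_sets) auto
  then show False using d(1) by (auto simp: null_sets_def)
qed

section \<open>The Lagrange identity and the maximal domain\<close>

lemma ac_density_cnj:
  assumes "ac_density l f g"
  shows "ac_density l (\<lambda>x. cnj (f x)) (\<lambda>x. cnj (g x))"
  unfolding ac_density_def
proof (intro conjI allI impI)
  show "loc_summable l (\<lambda>x. cnj (g x))"
    using ac_densityD(1)[OF assms]
    by (auto simp: loc_summable_def absolutely_integrable_on_def integrable_on_cnj_iff)
  fix x assume "l \<le> x"
  from ac_densityD(2)[OF assms this]
  show "cnj (f x) = cnj (f l) + integral {l..x} (\<lambda>x. cnj (g x))"
    by (simp flip: Henstock_Kurzweil_Integration.integral_cnj)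
qed

lemma sl_pair_imp_ac: "sl_pair l y p r \<Longrightarrow> ac_density l y p"
  using sl_pair_continuous[of l y p r] by (auto simp: sl_pair_def intro: ac_density_of_C1)

text \<open>The Lagrange bracket (Wronskian) of \<open>y\<close> and the conjugate of \<open>z\<close>.\<close>

definition bracket :: "real \<Rightarrow> fn \<Rightarrow> fn \<Rightarrow> real \<Rightarrow> complex" where
  "bracket l y z x = D1 l y x * cnj (z x) - y x * cnj (D1 l z x)"

text \<open>Both \<open>y' * cnj z\<close> and \<open>y * cnj z'\<close> obey the product rule, the terms \<open>y' * cnj z'\<close> cancel, and the
  potential drops out because it is real.\<close>

lemma lagrange_identity:
  assumes "sl_regular l y" "sl_regular l z" "l \<le> b"
  shows "((\<lambda>x. sl_expr l q y x * cnj (z x) - y x * cnj (sl_expr l q z x))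
    has_integral (bracket l y z l - bracket l y z b)) {l..b}"
proof -
  define p r where "p = D1 l y" and "r = ac_deriv l (D1 l y)"
  define p' r' where "p' = D1 l z" and "r' = ac_deriv l (D1 l z)"
  have y: "sl_pair l y p r" and z: "sl_pair l z p' r'"
    using assms sl_regular_pair unfolding p_def r_def p'_def r'_def by blast+
  have 1: "ac_density l (\<lambda>x. p x * cnj (z x)) (\<lambda>x. r x * cnj (z x) + p x * cnj (p' x))"
    using y z sl_pair_continuous[OF z]
    by (intro ac_density_mult) (auto simp: sl_pair_def intro!: has_vector_derivative_cnj continuous_intros)
  have 2: "ac_density l (\<lambda>x. cnj (p' x) * y x) (\<lambda>x. cnj (r' x) * y x + cnj (p' x) * p x)"
    using y z sl_pair_continuous[OF y]
    by (intro ac_density_mult ac_density_cnj) (auto simp: sl_pair_def)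
  have "((\<lambda>x. (-1) * (r x * cnj (z x) + p x * cnj (p' x)) + 1 * (cnj (r' x) * y x + cnj (p' x) * p x))
      has_integral (((-1) * (p b * cnj (z b)) + 1 * (cnj (p' b) * y b)) - ((-1) * (p l * cnj (z l)) + 1 * (cnj (p' l) * y l)))) {l..b}"
    using ac_density_integral[OF ac_density_linear[OF 1 2] order_refl assms(3)] .
  moreover have "(\<lambda>x. sl_expr l q y x * cnj (z x) - y x * cnj (sl_expr l q z x)) =
    (\<lambda>x. (-1) * (r x * cnj (z x) + p x * cnj (p' x)) + 1 * (cnj (r' x) * y x + cnj (p' x) * p x))"
    by (simp add: fun_eq_iff sl_expr_def p_def r_def p'_def r'_def algebra_simps)
  moreover have "bracket l y z l - bracket l y z b =
    ((-1) * (p b * cnj (z b)) + 1 * (cnj (p' b) * y b)) - ((-1) * (p l * cnj (z l)) + 1 * (cnj (p' l) * y l))"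
    by (simp add: bracket_def p_def p'_def algebra_simps)
  ultimately show ?thesis by (simp only:)
qed

lemma DstarD:
  assumes "y \<in> Dstar l q"
  shows "x < l \<Longrightarrow> y x = 0" "L2 l y" "sl_regular l y" "L2 l (sl_expr l q y)"
  using assms by (auto simp: Dstar_def)

lemma Dstar_pairI:
  assumes "sl_pair l y p r" "\<And>x. x < l \<Longrightarrow> y x = 0" "L2 l y"
    and "L2 l w" "AE x in lebesgue_on {l..}. - r x + of_real (q x) * y x = w x"
  shows "y \<in> Dstar l q" "x \<ge> l \<Longrightarrow> D1 l y x = p x"
    "AE x in lebesgue_on {l..}. sl_expr l q y x = w x"
proof -
  note reg = sl_pair_regular[OF assms(1)]
  show "D1 l y x = p x" if "x \<ge> l" using reg that by auto
  show ae: "AE x in lebesgue_on {l..}. sl_expr l q y x = w x"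
    using reg(3)[of q] assms(5) by eventually_elim simp
  then have "L2 l (sl_expr l q y)"
    by (intro L2_cong_AE[OF assms(4)]) (auto elim: eventually_mono)
  then show "y \<in> Dstar l q" using reg assms by (auto simp: Dstar_def)
qed

lemma Dstar_linear:
  fixes a b :: complex
  assumes "y \<in> Dstar l q" "z \<in> Dstar l q"
  defines "w \<equiv> \<lambda>x. a * y x + b * z x"
  shows "w \<in> Dstar l q" "x \<ge> l \<Longrightarrow> D1 l w x = a * D1 l y x + b * D1 l z x"
    "AE x in lebesgue_on {l..}. sl_expr l q w x = a * sl_expr l q y x + b * sl_expr l q z x"
proof -
  note p = sl_pair_linear[OF sl_regular_pair[OF DstarD(3)[OF assms(1)]] sl_regular_pair[OF DstarD(3)[OF assms(2)]], of a b]
  have ae: "AE x in lebesgue_on {l..}. - (a * ac_deriv l (D1 l y) x + b * ac_deriv l (D1 l z) x) + of_real (q x) * w x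
     = a * sl_expr l q y x + b * sl_expr l q z x"
    by (intro AE_I2) (simp add: sl_expr_def w_def algebra_simps)
  have L: "L2 l w" "L2 l (\<lambda>x. a * sl_expr l q y x + b * sl_expr l q z x)"
    unfolding w_def using assms by (auto intro!: L2_linear dest: DstarD)
  have z: "w x = 0" if "x < l" for x using DstarD(1)[OF assms(1) that] DstarD(1)[OF assms(2) that] by (simp add: w_def)
  note res = Dstar_pairI[OF p[folded w_def] z L ae]
  show "w \<in> Dstar l q" "x \<ge> l \<Longrightarrow> D1 l w x = a * D1 l y x + b * D1 l z x"
    "AE x in lebesgue_on {l..}. sl_expr l q w x = a * sl_expr l q y x + b * sl_expr l q z x"
    using res by auto
qed

lemma ip_sl_linear_left:
  assumes "y \<in> Dstar l q" "z \<in> Dstar l q" "L2 l f"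
  shows "ip l (sl_expr l q (\<lambda>x. a * y x + b * z x)) f =
    a * ip l (sl_expr l q y) f + b * ip l (sl_expr l q z) f"
proof -
  note lin = Dstar_linear[OF assms(1,2), where a=a and b=b]
  have "ip l (sl_expr l q (\<lambda>x. a * y x + b * z x)) f = ip l (\<lambda>x. a * sl_expr l q y x + b * sl_expr l q z x) f"
    by (rule ip_cong_AE_left[OF DstarD(4)[OF lin(1)] lin(3) assms(3)])
  also have "\<dots> = a * ip l (sl_expr l q y) f + b * ip l (sl_expr l q z) f"
    using assms by (intro ip_linear_left) (auto dest: DstarD)
  finally show ?thesis .
qed

text \<open>The Lagrange identity with the right endpoint sent to infinity. Only a limit of the bracket appears
  here; that this limit is zero is where nonnegativity of the minimal operator will enter.\<close>

lemma bracket_tendsto: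
  assumes "y \<in> Dstar l q" "z \<in> Dstar l q"
  shows "(\<lambda>n. bracket l y z (l + real n)) \<longlonglongrightarrow>
    bracket l y z l - (ip l (sl_expr l q y) z - ip l y (sl_expr l q z))"
proof -
  let ?M = "lebesgue_on {l..}"
  define F where "F x = sl_expr l q y x * cnj (z x) - y x * cnj (sl_expr l q z x)" for x
  have int: "integrable ?M (\<lambda>x. sl_expr l q y x * cnj (z x))" "integrable ?M (\<lambda>x. y x * cnj (sl_expr l q z x))"
    using assms by (auto intro!: L2_product_integrable dest: DstarD)
  then have F: "integrable ?M F" unfolding F_def by (rule Bochner_Integration.integrable_diff)
  have total: "integral\<^sup>L ?M F = ip l (sl_expr l q y) z - ip l y (sl_expr l q z)"
    unfolding F_def ip_def by (rule Bochner_Integration.integral_diff[OF int])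
  have part: "(LINT x|?M. indicator {l..l + real n} x *\<^sub>R F x) = bracket l y z l - bracket l y z (l + real n)" for n
  proof -
    have "(F has_integral (bracket l y z l - bracket l y z (l + real n))) {l..l + real n}"
      unfolding F_def using assms by (intro lagrange_identity) (auto dest: DstarD)
    moreover have "(F has_integral (LINT x|?M. indicator {l..l + real n} x *\<^sub>R F x)) {l..l + real n}"
    proof -
      have i: "integrable ?M (\<lambda>x. indicator {l..l + real n} x *\<^sub>R F x)"
        using F by (intro integrable_mult_indicator) (auto simp: sets_restrict_space_iff)
      have "((\<lambda>x. indicator {l..l + real n} x *\<^sub>R F x) has_integral (LINT x|?M. indicator {l..l + real n} x *\<^sub>R F x)) {l..}"
        using i by (intro has_integral_integral_lebesgue_on) auto
      then show ?thesis
        by (subst has_integral_restrict[symmetric, of "{l..l + real n}" "{l..}"])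
          (auto elim!: has_integral_eq[rotated] simp: indicator_def)
    qed
    ultimately show ?thesis by (rule has_integral_unique[symmetric])
  qed
  have "(\<lambda>n. LINT x|?M. indicator {l..l + real n} x *\<^sub>R F x) \<longlonglongrightarrow> integral\<^sup>L ?M F"
  proof (rule integral_dominated_convergence[where w = "\<lambda>x. norm (F x)"])
    show "F \<in> borel_measurable ?M" using F by auto
    show "(\<lambda>x. indicator {l..l + real n} x *\<^sub>R F x) \<in> borel_measurable ?M" for n
      using F by (intro borel_measurable_integrable integrable_mult_indicator) (auto simp: sets_restrict_space_iff)
    show "integrable ?M (\<lambda>x. norm (F x))" using F by auto
    show "AE x in ?M. (\<lambda>n. indicator {l..l + real n} x *\<^sub>R F x) \<longlonglongrightarrow> F x"
    proof (intro AE_I2 tendsto_eventually)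
      fix x assume "x \<in> space ?M"
      then have "l \<le> x" by simp
      obtain N where "x - l \<le> real N" using real_arch_simple by blast
      then have "\<forall>n\<ge>N. x \<le> l + real n" by (auto simp: algebra_simps intro: order_trans)
      then show "\<forall>\<^sub>F n in sequentially. indicator {l..l + real n} x *\<^sub>R F x = F x"
        unfolding eventually_sequentially using \<open>l \<le> x\<close> by (auto simp: indicator_def)
    qed
  qed (auto simp: indicator_def)
  then have "(\<lambda>n. bracket l y z l - (bracket l y z l - bracket l y z (l + real n))) \<longlonglongrightarrow>
     bracket l y z l - integral\<^sup>L ?M F"
    unfolding part by (intro tendsto_intros)
  then show ?thesis by (simp add: total)
qed

section \<open>Cutting off solutions near the endpoint\<close>

text \<open>A square of a truncated linear function. Its derivative is Lipschitz and its second derivative is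
  bounded, which suffices: for a solution \<open>y\<close> of \<open>l(y) = z y\<close> the locally summable potential occurs in
  \<open>l(\<chi> y) = z \<chi> y - 2 \<chi>' y' - \<chi>'' y\<close> only through \<open>z y\<close>. A smooth bump function alone would not do,
  since the product of the potential with it need not be square integrable.\<close>

definition cutoff :: "real \<Rightarrow> real \<Rightarrow> real \<Rightarrow> real" where
  "cutoff l k x = (max 0 (1 - k * (x - l)))\<^sup>2"

definition cutoff' :: "real \<Rightarrow> real \<Rightarrow> real \<Rightarrow> real" where
  "cutoff' l k x = - 2 * k * max 0 (1 - k * (x - l))"

definition cutoff'' :: "real \<Rightarrow> real \<Rightarrow> real \<Rightarrow> real" where
  "cutoff'' l k x = (if x \<le> l + 1 / k then 2 * k\<^sup>2 else 0)"

lemma cutoff_derivative: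
  "((\<lambda>x. complex_of_real (cutoff l k x)) has_vector_derivative of_real (cutoff' l k x)) (at x within S)"
proof -
  have "((\<lambda>t. (max 0 t)\<^sup>2) has_real_derivative 2 * max 0 t) (at t)" for t :: real
  proof (cases t "0::real" rule: linorder_cases)
    case less
    have "((\<lambda>t. 0) has_real_derivative 2 * max 0 t) (at t)" using less by (auto intro!: derivative_eq_intros)
    moreover have "\<forall>\<^sub>F s in nhds t. (max 0 s)\<^sup>2 = (0::real)"
      using less by (intro eventually_nhds_in_open[THEN eventually_mono, of "{..<0}"]) auto
    ultimately show ?thesis by (subst DERIV_cong_ev[OF refl _ refl, of _ "\<lambda>_. 0"])
  next
    case greater
    have "((\<lambda>t. t\<^sup>2) has_real_derivative 2 * max 0 t) (at t)" using greater by (auto intro!: derivative_eq_intros)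
    moreover have "\<forall>\<^sub>F s in nhds t. (max 0 s)\<^sup>2 = s\<^sup>2"
      using greater by (intro eventually_nhds_in_open[THEN eventually_mono, of "{0<..}"]) auto
    ultimately show ?thesis by (subst DERIV_cong_ev[OF refl _ refl, of _ "\<lambda>t. t\<^sup>2"])
  next
    case equal
    have "((\<lambda>s. max 0 s) \<longlongrightarrow> max 0 0) (at (0::real))" by (intro tendsto_intros)
    then have "((\<lambda>s. max 0 s) \<longlongrightarrow> 0) (at (0::real))" by simp
    then have "((\<lambda>s. (max 0 s)\<^sup>2 / s) \<longlongrightarrow> 0) (at (0::real))"
      by (rule Lim_transform_eventually)
        (auto simp: eventually_at_filter max_def power2_eq_square intro!: always_eventually)
    then show ?thesis using equal by (simp add: has_field_derivative_iff)
  qed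
  then have sq: "((\<lambda>t. (max 0 t)\<^sup>2) has_real_derivative 2 * max 0 (1 - k * (x - l))) (at (1 - k * (x - l)))" .
  have lin: "((\<lambda>x. 1 - k * (x - l)) has_real_derivative - k) (at x within S)"
    by (auto intro!: derivative_eq_intros)
  have "((\<lambda>x. (max 0 (1 - k * (x - l)))\<^sup>2) has_real_derivative 2 * max 0 (1 - k * (x - l)) * - k) (at x within S)"
    by (rule DERIV_chain2[where f = "\<lambda>t. (max 0 t)\<^sup>2" and g = "\<lambda>x. 1 - k * (x - l)", OF sq lin])
  moreover have "2 * max 0 (1 - k * (x - l)) * - k = cutoff' l k x" by (simp add: cutoff'_def)
  ultimately have "(cutoff l k has_real_derivative cutoff' l k x) (at x within S)"
    unfolding cutoff_def[abs_def] by simp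
  then show ?thesis
    by (intro has_vector_derivative_of_real) (simp add: has_real_derivative_iff_has_vector_derivative)
qed

lemma cutoff'_ac:
  assumes "k > 0"
  shows "ac_density l (\<lambda>x. complex_of_real (cutoff' l k x)) (\<lambda>x. of_real (cutoff'' l k x))"
  unfolding ac_density_def
proof (intro conjI allI impI)
  have eq: "(\<lambda>x. complex_of_real (cutoff'' l k x)) = (\<lambda>x. indicator {..l + 1/k} x *\<^sub>R of_real (2 * k\<^sup>2))"
    by (auto simp: cutoff''_def indicator_def fun_eq_iff)
  show "loc_summable l (\<lambda>x. complex_of_real (cutoff'' l k x))"
    unfolding loc_summable_def
  proof
    fix b
    have "(\<lambda>x. complex_of_real (2 * k\<^sup>2)) absolutely_integrable_on {l..min b (l + 1/k)}"
      by (metis absolutely_integrable_continuous box_real(2) continuous_on_const)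
    moreover have "(\<lambda>x. indicator {l..b} x *\<^sub>R (indicator {..l + 1/k} x *\<^sub>R complex_of_real (2 * k\<^sup>2)))
        = (\<lambda>x. indicator {l..min b (l + 1/k)} x *\<^sub>R complex_of_real (2 * k\<^sup>2))"
      by (auto simp: indicator_def)
    ultimately show "(\<lambda>x. complex_of_real (cutoff'' l k x)) absolutely_integrable_on {l..b}"
      unfolding eq set_integrable_def by (simp only:)
  qed
  fix x assume x: "l \<le> x"
  have "(cutoff'' l k has_integral (cutoff' l k x - cutoff' l k l)) {l..x}"
  proof (rule fundamental_theorem_of_calculus_interior_strong[of "{l + 1/k}"])
    show "continuous_on {l..x} (cutoff' l k)" unfolding cutoff'_def by (intro continuous_intros)
    fix t assume t: "t \<in> {l<..<x} - {l + 1/k}"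
    show "(cutoff' l k has_vector_derivative cutoff'' l k t) (at t)"
    proof (cases "t < l + 1/k")
      case True
      have "((\<lambda>t. - 2 * k * (1 - k * (t - l))) has_real_derivative 2 * k\<^sup>2) (at t)"
        by (auto intro!: derivative_eq_intros simp: power2_eq_square)
      moreover have "\<forall>\<^sub>F s in nhds t. cutoff' l k s = - 2 * k * (1 - k * (s - l))"
        using True assms by (intro eventually_nhds_in_open[THEN eventually_mono, of "{..<l + 1/k}"])
          (auto simp: cutoff'_def field_simps)
      ultimately have "(cutoff' l k has_real_derivative 2 * k\<^sup>2) (at t)"
        by (subst DERIV_cong_ev[OF refl _ refl])
      then show ?thesis using True by (simp add: has_real_derivative_iff_has_vector_derivative cutoff''_def)
    next
      case False
      then have g: "t > l + 1/k" using t by auto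
      have "((\<lambda>t. 0) has_real_derivative 0) (at t)" by simp
      moreover have "\<forall>\<^sub>F s in nhds t. cutoff' l k s = 0"
        using g assms by (intro eventually_nhds_in_open[THEN eventually_mono, of "{l + 1/k<..}"])
          (auto simp: cutoff'_def field_simps)
      ultimately have "(cutoff' l k has_real_derivative 0) (at t)"
        by (subst DERIV_cong_ev[OF refl _ refl])
      then show ?thesis using g by (simp add: has_real_derivative_iff_has_vector_derivative cutoff''_def)
    qed
  qed (use x in auto)
  then have "((\<lambda>x. complex_of_real (cutoff'' l k x)) has_integral of_real (cutoff' l k x - cutoff' l k l)) {l..x}"
    by (rule has_integral_of_real)
  then show "complex_of_real (cutoff' l k x) = of_real (cutoff' l k l) + integral {l..x} (\<lambda>x. of_real (cutoff'' l k x))"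
    by (simp add: integral_unique)
qed

lemma sl_pair_cutoff:
  assumes y: "sl_pair l y p r" and "k > 0"
  shows "sl_pair l (\<lambda>x. of_real (cutoff l k x) * y x)
     (\<lambda>x. of_real (cutoff' l k x) * y x + of_real (cutoff l k x) * p x)
     (\<lambda>x. of_real (cutoff'' l k x) * y x + 2 * of_real (cutoff' l k x) * p x + of_real (cutoff l k x) * r x)"
  unfolding sl_pair_def
proof (intro conjI allI impI)
  fix x assume "l \<le> x"
  then show "((\<lambda>x. of_real (cutoff l k x) * y x) has_vector_derivative
      (of_real (cutoff' l k x) * y x + of_real (cutoff l k x) * p x)) (at x within {l..})"
    using has_vector_derivative_mult[OF cutoff_derivative, of y "p x" x "{l..}" l k] y
    by (auto simp: sl_pair_def algebra_simps)
next
  have c: "continuous_on {l..} (\<lambda>x. complex_of_real (cutoff' l k x))"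
    unfolding cutoff'_def by (intro continuous_intros)
  have 1: "ac_density l (\<lambda>x. of_real (cutoff' l k x) * y x)
      (\<lambda>x. of_real (cutoff'' l k x) * y x + of_real (cutoff' l k x) * p x)"
    using y sl_pair_continuous[OF y] cutoff'_ac[OF assms(2)]
    by (intro ac_density_mult) (auto simp: sl_pair_def)
  have 2: "ac_density l (\<lambda>x. p x * of_real (cutoff l k x))
      (\<lambda>x. r x * of_real (cutoff l k x) + p x * of_real (cutoff' l k x))"
    using y c cutoff_derivative by (intro ac_density_mult) (auto simp: sl_pair_def)
  from ac_density_linear[OF 1 2, of 1 1]
  show "ac_density l (\<lambda>x. of_real (cutoff' l k x) * y x + of_real (cutoff l k x) * p x)
     (\<lambda>x. of_real (cutoff'' l k x) * y x + 2 * of_real (cutoff' l k x) * p x + of_real (cutoff l k x) * r x)"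
    by (simp add: algebra_simps)
qed

lemma integrable_bounded_indicator:
  assumes "l \<le> c"
  shows "integrable (lebesgue_on {l..}) (\<lambda>x. K * indicator {l..c} x :: real)"
    and "(LINT x|lebesgue_on {l..}. K * indicator {l..c} x) = K * (c - l)"
proof -
  have e: "emeasure (lebesgue_on {l..}) {l..c} = ennreal (c - l)"
    using assms by (subst emeasure_restrict_space) auto
  have s: "{l..c} \<in> sets (lebesgue_on {l..})" by (auto simp: sets_restrict_space_iff)
  show "integrable (lebesgue_on {l..}) (\<lambda>x. K * indicator {l..c} x :: real)"
    using e s by (intro integrable_mult_right) (auto simp: integrable_indicator_iff)
  show "(LINT x|lebesgue_on {l..}. K * indicator {l..c} x) = K * (c - l)"
    using e s assms by (simp add: measure_def)
qed

lemma L2_bounded_compact: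
  assumes "f \<in> borel_measurable (lebesgue_on {l..})"
    and "\<And>x. x \<ge> l \<Longrightarrow> cmod (f x) \<le> K * indicator {l..c} x" and "l \<le> c"
  shows "L2 l f"
  unfolding L2_def
proof
  show "integrable (lebesgue_on {l..}) (\<lambda>x. (cmod (f x))\<^sup>2)"
  proof (rule Bochner_Integration.integrable_bound[OF integrable_bounded_indicator(1)[OF assms(3), of "K\<^sup>2"]])
    show "(\<lambda>x. (cmod (f x))\<^sup>2) \<in> borel_measurable (lebesgue_on {l..})" using assms(1) by measurable
    have "(cmod (f x))\<^sup>2 \<le> K\<^sup>2 * indicator {l..c} x" if "x \<ge> l" for x
      using power_mono[OF assms(2)[OF that], of 2] by (auto simp: indicator_def power_mult_distrib)
    then show "AE x in lebesgue_on {l..}. norm ((cmod (f x))\<^sup>2) \<le> norm (K\<^sup>2 * indicat_real {l..c} x)"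
      by (intro AE_I2) (auto simp: abs_mult)
  qed
qed (fact assms(1))

lemma norm_ip_le:
  assumes "L2 l f" "L2 l g" "integrable (lebesgue_on {l..}) h"
    and "AE x in lebesgue_on {l..}. cmod (f x) * cmod (g x) \<le> h x"
  shows "cmod (ip l f g) \<le> integral\<^sup>L (lebesgue_on {l..}) h"
proof -
  have i: "integrable (lebesgue_on {l..}) (\<lambda>x. f x * cnj (g x))" using assms L2_product_integrable by blast
  have "cmod (ip l f g) \<le> (LINT x|lebesgue_on {l..}. cmod (f x * cnj (g x)))"
    unfolding ip_def by (rule integral_norm_bound)
  also have "\<dots> \<le> integral\<^sup>L (lebesgue_on {l..}) h"
    using integrable_norm[OF i] assms(3,4) by (intro integral_mono_AE) (auto simp: norm_mult)
  finally show ?thesis .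
qed

lemma norm_cutoff_terms_le:
  fixes z u v :: complex and c c' c'' :: real
  assumes "\<bar>c\<bar> \<le> 1" "\<bar>c'\<bar> \<le> K'" "\<bar>c''\<bar> = K''" "cmod u \<le> U" "cmod v \<le> V"
  shows "cmod (z * of_real c * u - 2 * of_real c' * v - of_real c'' * u)
    \<le> cmod z * U + 2 * K' * V + K'' * U"
proof -
  have "\<bar>c\<bar> * cmod u \<le> 1 * U" using assms by (intro mult_mono) auto
  then have 1: "cmod (z * of_real c * u) \<le> cmod z * U"
    by (simp add: norm_mult mult.assoc mult_left_mono)
  have "\<bar>c'\<bar> * cmod v \<le> K' * V" using assms by (intro mult_mono) auto
  then have 2: "cmod (2 * of_real c' * v) \<le> 2 * K' * V" by (simp add: norm_mult)
  have "\<bar>c''\<bar> * cmod u \<le> K'' * U" using assms by (intro mult_mono) auto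
  then have 3: "cmod (of_real c'' * u) \<le> K'' * U" by (simp add: norm_mult)
  show ?thesis
    using 1 2 3 norm_triangle_ineq4[of "z * of_real c * u - 2 * of_real c' * v" "of_real c'' * u"]
      norm_triangle_ineq4[of "z * of_real c * u" "2 * of_real c' * v"] by linarith
qed

definition truncation :: "real \<Rightarrow> real \<Rightarrow> fn \<Rightarrow> fn" where
  "truncation l k y x = (if x < l then 0 else of_real (cutoff l k x) * y x)"

lemma cutoff_bounds:
  assumes "k > 0" "x \<ge> l"
  shows "\<bar>cutoff l k x\<bar> \<le> indicator {l..l + 1/k} x" "\<bar>cutoff' l k x\<bar> \<le> 2 * k * indicator {l..l + 1/k} x"
    "\<bar>cutoff'' l k x\<bar> = 2 * k\<^sup>2 * indicator {l..l + 1/k} x"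
proof -
  have le1: "max 0 (1 - k * (x - l)) \<le> indicator {l..l + 1/k} x"
    using assms by (auto simp: indicator_def field_simps max_def)
  have "(max 0 (1 - k * (x - l)))\<^sup>2 \<le> (indicator {l..l + 1/k} x)\<^sup>2"
    by (rule power_mono[OF le1]) auto
  also have "(indicator {l..l + 1/k} x)\<^sup>2 = (indicator {l..l + 1/k} x :: real)"
    by (simp add: indicator_def)
  finally show "\<bar>cutoff l k x\<bar> \<le> indicator {l..l + 1/k} x"
    by (simp only: cutoff_def abs_power2)
  show "\<bar>cutoff' l k x\<bar> \<le> 2 * k * indicator {l..l + 1/k} x"
    using mult_left_mono[OF le1, of "2 * k"] assms by (auto simp: cutoff'_def abs_mult)
  show "\<bar>cutoff'' l k x\<bar> = 2 * k\<^sup>2 * indicator {l..l + 1/k} x"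
    using assms by (auto simp: cutoff''_def indicator_def)
qed

lemma sl_solution_pair:
  assumes "sl_solution l q z a b y"
  obtains r where "sl_pair l y (D1 l y) r"
    "AE x in lebesgue_on {l..}. - r x + of_real (q x) * y x = z * y x"
proof
  show "sl_pair l y (D1 l y) (ac_deriv l (D1 l y))"
    using assms sl_regular_pair by (auto simp: sl_solution_def)
  show "AE x in lebesgue_on {l..}. - ac_deriv l (D1 l y) x + of_real (q x) * y x = z * y x"
    using assms by (auto simp: sl_solution_def sl_expr_def)
qed

text \<open>Truncated solutions are compactly supported elements of the maximal domain. Their boundary data at
  the endpoint differ from those of the solution only by \<open>\<chi>'(l) = - 2 k\<close> times its value there.\<close>

lemma truncation_Dstar:
  assumes y: "sl_solution l q z a b y" and k: "k > 0"
  shows "truncation l k y \<in> Dstar l q" "truncation l k y l = a"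
    "D1 l (truncation l k y) l = b - 2 * of_real k * a"
    "x > l + 1 / k \<Longrightarrow> truncation l k y x = 0 \<and> D1 l (truncation l k y) x = 0"
    "AE x in lebesgue_on {l..}. sl_expr l q (truncation l k y) x =
       z * of_real (cutoff l k x) * y x - 2 * of_real (cutoff' l k x) * D1 l y x - of_real (cutoff'' l k x) * y x"
proof -
  obtain r where p: "sl_pair l y (D1 l y) r"
    and r: "AE x in lebesgue_on {l..}. - r x + of_real (q x) * y x = z * y x"
    using sl_solution_pair[OF y] .
  define w where "w x = z * of_real (cutoff l k x) * y x - 2 * of_real (cutoff' l k x) * D1 l y x
      - of_real (cutoff'' l k x) * y x" for x
  have y0: "y l = a" "D1 l y l = b" using y by (auto simp: sl_solution_def)
  have pt: "sl_pair l (truncation l k y)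
     (\<lambda>x. of_real (cutoff' l k x) * y x + of_real (cutoff l k x) * D1 l y x)
     (\<lambda>x. of_real (cutoff'' l k x) * y x + 2 * of_real (cutoff' l k x) * D1 l y x + of_real (cutoff l k x) * r x)"
    by (rule sl_pair_cong[OF sl_pair_cutoff[OF p k]]) (auto simp: truncation_def)
  have ae: "AE x in lebesgue_on {l..}. - (of_real (cutoff'' l k x) * y x + 2 * of_real (cutoff' l k x) * D1 l y x
      + of_real (cutoff l k x) * r x) + of_real (q x) * truncation l k y x = w x"
  proof -
    have "AE x in lebesgue_on {l..}. x \<ge> l" by (intro AE_I2) auto
    with r show ?thesis
    proof eventually_elim
      case (elim x)
      have "- (of_real (cutoff'' l k x) * y x + 2 * of_real (cutoff' l k x) * D1 l y x
          + of_real (cutoff l k x) * r x) + of_real (q x) * truncation l k y x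
        = of_real (cutoff l k x) * (- r x + of_real (q x) * y x)
          - 2 * of_real (cutoff' l k x) * D1 l y x - of_real (cutoff'' l k x) * y x"
        using elim(2) by (simp add: truncation_def algebra_simps)
      then show ?case unfolding elim(1) by (simp add: w_def mult_ac)
    qed
  qed
  note c = sl_pair_continuous[OF p]
  have "compact (y ` {l..l + 1/k})" "compact (D1 l y ` {l..l + 1/k})"
    using c by (auto intro!: compact_continuous_image intro: continuous_on_subset)
  then have "bounded (y ` {l..l + 1/k})" "bounded (D1 l y ` {l..l + 1/k})"
    by (auto intro: compact_imp_bounded)
  then obtain M M' where "\<forall>v\<in>y ` {l..l + 1/k}. cmod v \<le> M" "\<forall>v\<in>D1 l y ` {l..l + 1/k}. cmod v \<le> M'"
    unfolding bounded_iff by blast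
  then have M: "\<And>x. x \<in> {l..l + 1/k} \<Longrightarrow> cmod (y x) \<le> M"
    "\<And>x. x \<in> {l..l + 1/k} \<Longrightarrow> cmod (D1 l y x) \<le> M'" by blast+
  have m: "y \<in> borel_measurable (lebesgue_on {l..})" "D1 l y \<in> borel_measurable (lebesgue_on {l..})"
    using c by (auto intro: continuous_imp_measurable_on_sets_lebesgue)
  have mc: "(\<lambda>x. complex_of_real (cutoff l k x)) \<in> borel_measurable (lebesgue_on {l..})"
    "(\<lambda>x. complex_of_real (cutoff' l k x)) \<in> borel_measurable (lebesgue_on {l..})"
    unfolding cutoff_def cutoff'_def
    by (rule continuous_imp_measurable_on_sets_lebesgue; (intro continuous_intros)?; simp)+
  have mc'': "(\<lambda>x. complex_of_real (cutoff'' l k x)) \<in> borel_measurable (lebesgue_on {l..})"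
  proof -
    have "cutoff'' l k \<in> borel_measurable borel" unfolding cutoff''_def by measurable
    then have "cutoff'' l k \<in> borel_measurable (lebesgue_on {l..})"
      by (intro measurable_restrict_space1 measurable_completion) auto
    then show ?thesis by measurable
  qed
  have L2w: "L2 l w"
  proof (rule L2_bounded_compact)
    show "w \<in> borel_measurable (lebesgue_on {l..})"
      unfolding w_def using m mc mc'' by (intro borel_measurable_diff borel_measurable_times borel_measurable_const)
    show "l \<le> l + 1/k" using k by simp
    fix x assume x: "x \<ge> l"
    show "cmod (w x) \<le> (cmod z * M + 2 * (2 * k) * M' + 2 * k\<^sup>2 * M) * indicator {l..l + 1/k} x"
    proof (cases "x \<in> {l..l+1/k}")
      case True
      have "cmod (w x) \<le> cmod z * M + 2 * (2 * k) * M' + 2 * k\<^sup>2 * M"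
        unfolding w_def using cutoff_bounds[OF k x] True M[OF True]
        by (intro norm_cutoff_terms_le) auto
      then show ?thesis using True by simp
    next
      case False
      then have "cutoff l k x = 0" "cutoff' l k x = 0" "cutoff'' l k x = 0"
        using cutoff_bounds[OF k x] by auto
      then show ?thesis using False by (simp add: w_def)
    qed
  qed
  have L2t: "L2 l (truncation l k y)"
  proof (rule L2_bounded_compact)
    have "(\<lambda>x. of_real (cutoff l k x) * y x) \<in> borel_measurable (lebesgue_on {l..})"
      using m mc by (intro borel_measurable_times)
    then show "truncation l k y \<in> borel_measurable (lebesgue_on {l..})"
      by (rule measurable_cong[THEN iffD1, rotated]) (auto simp: truncation_def)
    show "l \<le> l + 1/k" using k by simp
    fix x assume x: "x \<ge> l"
    show "cmod (truncation l k y x) \<le> M * indicator {l..l + 1/k} x"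
    proof (cases "x \<in> {l..l+1/k}")
      case True
      have "cmod (truncation l k y x) \<le> 1 * M"
        using mult_mono[of "\<bar>cutoff l k x\<bar>" 1 "cmod (y x)" M] cutoff_bounds[OF k x] True M[OF True] x
        by (simp add: truncation_def norm_mult)
      then show ?thesis using True by simp
    qed (use cutoff_bounds[OF k x] x in \<open>auto simp: truncation_def\<close>)
  qed
  note res = Dstar_pairI[OF pt _ L2t L2w ae]
  have nz: "truncation l k y x = 0" if "x < l" for x using that by (simp add: truncation_def)
  show "truncation l k y \<in> Dstar l q" using res(1) nz by blast
  show "truncation l k y l = a" by (simp add: truncation_def cutoff_def y0)
  show "D1 l (truncation l k y) l = b - 2 * of_real k * a"
    using res(2)[OF nz, of l] by (simp add: cutoff_def cutoff'_def y0)
  show "truncation l k y x = 0 \<and> D1 l (truncation l k y) x = 0" if x: "x > l + 1 / k" for x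
  proof -
    have "x \<ge> l" using x k by (meson less_eq_real_def less_add_same_cancel1 order_trans zero_less_divide_1_iff)
    moreover from this have "cutoff l k x = 0" "cutoff' l k x = 0"
      using cutoff_bounds[OF k, of l x] x by auto
    ultimately show ?thesis using res(2)[OF nz, of x] by (simp add: truncation_def[of l k y x])
  qed
  show "AE x in lebesgue_on {l..}. sl_expr l q (truncation l k y) x =
       z * of_real (cutoff l k x) * y x - 2 * of_real (cutoff' l k x) * D1 l y x - of_real (cutoff'' l k x) * y x"
    using res(3)[OF nz] by (simp add: w_def)
qed

text \<open>For a solution with \<open>y(l) = 0\<close> and \<open>y'(l) = 1\<close>, the truncation to a layer of width \<open>1 / k\<close> keeps the unit
  derivative at the endpoint but becomes negligible: it has size \<open>O(1 / k)\<close>, the differential expression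
  has size \<open>O(k)\<close>, so the quadratic form has a bounded integrand on an interval of length \<open>1 / k\<close>.\<close>

lemma boundary_layer:
  assumes y: "sl_solution l q z 0 1 y"
  obtains M where "\<And>k. k \<ge> 1 \<Longrightarrow> cmod (ip l (sl_expr l q (truncation l k y)) (truncation l k y)) \<le> M / k"
    "\<And>k F. k \<ge> 1 \<Longrightarrow> L2 l F \<Longrightarrow> cmod (ip l (truncation l k y) F) \<le> M / k * (1 + Re (ip l F F))"
proof -
  obtain r where p: "sl_pair l y (D1 l y) r"
    using sl_solution_pair[OF y] .
  note c = sl_pair_continuous[OF p]
  have "compact (D1 l y ` {l..l + 1})"
    using c by (auto intro!: compact_continuous_image intro: continuous_on_subset)
  then obtain M where M: "M > 0" "\<And>x. x \<in> {l..l + 1} \<Longrightarrow> cmod (D1 l y x) \<le> M"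
    by (metis compact_imp_bounded bounded_pos imageI)
  have y0: "y l = 0" using y by (simp add: sl_solution_def)
  have sub: "x \<in> {l..l+1/k} \<Longrightarrow> x \<in> {l..l+1}" if "k \<ge> 1" for x k :: real
    using that by (auto intro: order_trans)
  have yb: "cmod (y x) \<le> M / k" if "k \<ge> 1" "x \<in> {l..l+1/k}" for x k
  proof -
    have "x \<in> {l..l+1}" using sub that by blast
    have "(D1 l y has_integral (y x - y l)) {l..x}"
      using that by (intro ac_density_integral[OF sl_pair_imp_ac[OF p]]) auto
    then have "cmod (y x - y l) \<le> M * (x - l)"
      using has_integral_bound_real[of M "{}" "D1 l y" "y x - y l" l x] M that \<open>x \<in> {l..l+1}\<close> by auto
    also have "\<dots> \<le> M * (1 / k)" using that M by (intro mult_left_mono) auto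
    finally show ?thesis by (simp add: y0)
  qed
  have tb: "cmod (truncation l k y x) \<le> M / k * indicator {l..l+1/k} x" if "k \<ge> 1" "x \<ge> l" for x k
  proof (cases "x \<in> {l..l+1/k}")
    case True
    have "cmod (truncation l k y x) \<le> 1 * (M / k)"
      using mult_mono[of "\<bar>cutoff l k x\<bar>" 1 "cmod (y x)" "M / k"]
        cutoff_bounds(1)[of k l x] yb[OF that(1) True] True that
      by (simp add: truncation_def norm_mult)
    then show ?thesis using True by simp
  qed (use cutoff_bounds(1)[of k l x] that in \<open>auto simp: truncation_def\<close>)
  define C where "C = cmod z * M * M + 6 * M * M + 2 * M"
  have C: "M \<le> C" "(cmod z * M + 6 * M) * M \<le> C" 
    using M by (auto simp: C_def algebra_simps)
  have 1: "cmod (ip l (sl_expr l q (truncation l k y)) (truncation l k y)) \<le> C / k" if k: "k \<ge> 1" for k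
  proof -
    note t = truncation_Dstar[OF y, of k]
    have k0: "k > 0" using k by simp
    have "cmod (ip l (sl_expr l q (truncation l k y)) (truncation l k y))
        \<le> (LINT x|lebesgue_on {l..}. C * indicator {l..l+1/k} x)"
    proof (rule norm_ip_le)
      show "L2 l (sl_expr l q (truncation l k y))" "L2 l (truncation l k y)"
        using DstarD t(1)[OF k0] by blast+
      show "integrable (lebesgue_on {l..}) (\<lambda>x. C * indicat_real {l..l + 1 / k} x)"
        using k by (intro integrable_bounded_indicator) auto
      have "AE x in lebesgue_on {l..}. x \<ge> l" by (intro AE_I2) auto
      with t(5)[OF k0]
      show "AE x in lebesgue_on {l..}. cmod (sl_expr l q (truncation l k y) x) * cmod (truncation l k y x)
          \<le> C * indicat_real {l..l + 1 / k} x"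
      proof eventually_elim
        case (elim x)
        show ?case
        proof (cases "x \<in> {l..l+1/k}")
          case True
          have "cmod (sl_expr l q (truncation l k y) x)
              \<le> cmod z * (M / k) + 2 * (2 * k) * M + 2 * k\<^sup>2 * (M / k)"
            unfolding elim(1)
            using cutoff_bounds[OF k0 elim(2)] True M(2)[OF sub[OF k True]] yb[OF k True]
            by (intro norm_cutoff_terms_le) auto
          also have "\<dots> \<le> (cmod z * M + 6 * M) * k"
          proof -
            have "M / k \<le> M * k"
            proof -
              have "M / k \<le> M / 1" using k M(1) by (intro divide_left_mono) auto
              also have "\<dots> \<le> M * k" using k M(1) by simp
              finally show ?thesis .
            qed
            then have "cmod z * (M / k) \<le> cmod z * (M * k)" by (rule mult_left_mono) simp
            moreover have "2 * k\<^sup>2 * (M / k) = 2 * k * M" using k0 by (simp add: power2_eq_square)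
            ultimately show ?thesis by (simp add: algebra_simps)
          qed
          finally have "cmod (sl_expr l q (truncation l k y) x) * cmod (truncation l k y x)
             \<le> ((cmod z * M + 6 * M) * k) * (M / k)"
            using tb[OF k elim(2)] True M(1) k0 by (intro mult_mono) auto
          also have "\<dots> = (cmod z * M + 6 * M) * M" using k0 by simp
          also have "\<dots> \<le> C" by (rule C)
          finally show ?thesis using True by simp
        next
          case False
          then show ?thesis using tb[OF k elim(2)] by simp
        qed
      qed
    qed
    also have "\<dots> = C * (1 / k)"
      using integrable_bounded_indicator(2)[of l "l + 1/k" C] k0 by simp
    finally show ?thesis by simp
  qed
  have 2: "cmod (ip l (truncation l k y) F) \<le> C / k * (1 + Re (ip l F F))" if k: "k \<ge> 1" and F: "L2 l F" for k F
  proof -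
    have k0: "k > 0" using k by simp
    have iF: "integrable (lebesgue_on {l..}) (\<lambda>x. (cmod (F x))\<^sup>2)" using F by (simp add: L2_def)
    have "cmod (ip l (truncation l k y) F)
      \<le> (LINT x|lebesgue_on {l..}. M / k * indicator {l..l+1/k} x + M / k * (cmod (F x))\<^sup>2)"
    proof (rule norm_ip_le[OF _ F])
      show "L2 l (truncation l k y)" using DstarD truncation_Dstar(1)[OF y k0] by blast
      show "integrable (lebesgue_on {l..}) (\<lambda>x. M / k * indicat_real {l..l + 1 / k} x + M / k * (cmod (F x))\<^sup>2)"
        using k0 iF by (intro Bochner_Integration.integrable_add integrable_bounded_indicator integrable_mult_right) auto
      show "AE x in lebesgue_on {l..}. cmod (truncation l k y x) * cmod (F x)
           \<le> M / k * indicat_real {l..l + 1 / k} x + M / k * (cmod (F x))\<^sup>2"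
      proof (rule AE_I2)
        fix x assume "x \<in> space (lebesgue_on {l..})"
        then have x: "x \<ge> l" by simp
        have a: "a \<le> 1 + a\<^sup>2" for a :: real
          using zero_le_power2[of "a - 1/2"] by (simp add: power2_eq_square algebra_simps)
        have "cmod (truncation l k y x) * cmod (F x) \<le> M / k * indicator {l..l+1/k} x * cmod (F x)"
          using tb[OF k x] by (intro mult_right_mono) auto
        also have "\<dots> \<le> M / k * indicator {l..l+1/k} x * (1 + (cmod (F x))\<^sup>2)"
          using a M k0 by (intro mult_left_mono) auto
        also have "\<dots> \<le> M / k * indicat_real {l..l + 1 / k} x + M / k * (cmod (F x))\<^sup>2"
          using M(1) k0 by (auto simp: indicator_def algebra_simps add_divide_distrib)
        finally show "cmod (truncation l k y x) * cmod (F x)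
           \<le> M / k * indicat_real {l..l + 1 / k} x + M / k * (cmod (F x))\<^sup>2" .
      qed
    qed
    also have "\<dots> = M / k * (1 / k) + M / k * Re (ip l F F)"
      unfolding ip_self_eq using k0 iF
      by (subst Bochner_Integration.integral_add)
        (auto simp: integrable_bounded_indicator(2) intro!: integrable_bounded_indicator(1)
          simp del: integral_mult_right_zero)
    also have "\<dots> \<le> M / k * (1 + Re (ip l F F))"
      using k k0 M(1) by (simp add: distrib_left field_simps)
    also have "\<dots> \<le> C / k * (1 + Re (ip l F F))"
      using C(1) k0 ip_self_nonneg[of l F] by (intro mult_right_mono divide_right_mono) auto
    finally show ?thesis .
  qed
  from that[of C] 1 2 show ?thesis by blast
qed

section \<open>Green's formula and the boundary form\<close>

locale nonneg_schroedinger =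
  fixes l :: real and q :: "real \<Rightarrow> real" and m_inf :: "complex \<Rightarrow> complex"
  assumes nonneg: "nonnegative_op l (min_op l q)"
    and weyl: "weyl_function l q m_inf"
begin

abbreviation "D \<equiv> Dstar l q"
abbreviation "L \<equiv> sl_expr l q"

lemma fundamental_solutions:
  obtains \<phi>1 \<phi>2 where "sl_solution l q (- 1) 0 1 \<phi>1" "sl_solution l q (- 1) (- 1) 0 \<phi>2"
proof -
  have "- 1 \<notin> \<real>\<^sub>\<ge>\<^sub>0" by (simp add: complex_nonneg_Reals_iff)
  then show ?thesis using that weyl unfolding weyl_function_def by blast
qed

text \<open>Truncated solutions realise all boundary data at the endpoint. Subtracting one of them puts an element of
  the maximal domain into the minimal domain without changing it far away.\<close>

lemma modify_near_endpoint:
  assumes "y \<in> D"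
  obtains f where "f \<in> D" "f l = 0" "D1 l f l = 0"
    "\<And>x. x > l + 1 \<Longrightarrow> f x = y x \<and> D1 l f x = D1 l y x"
proof -
  obtain \<phi>1 \<phi>2 where s: "sl_solution l q (- 1) 0 1 \<phi>1" "sl_solution l q (- 1) (- 1) 0 \<phi>2"
    by (rule fundamental_solutions)
  define c1 c2 where "c1 = truncation l 1 \<phi>1" and "c2 = truncation l 1 \<phi>2"
  note c1 = truncation_Dstar[OF s(1) zero_less_one, folded c1_def]
  note c2 = truncation_Dstar[OF s(2) zero_less_one, folded c2_def]
  \<comment> \<open>The truncations have data \<open>(0, 1)\<close> and \<open>(-1, 2)\<close> at the endpoint, the 2 coming from \<open>- 2 k\<close> with \<open>k = 1\<close>.\<close>
  define a b where "a = D1 l y l + 2 * y l" and "b = - y l"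
  define w where "w x = a * c1 x + b * c2 x" for x
  define f where "f x = 1 * y x + (-1) * w x" for x
  have w: "w \<in> D" "\<And>x. x \<ge> l \<Longrightarrow> D1 l w x = a * D1 l c1 x + b * D1 l c2 x"
    using Dstar_linear[OF c1(1) c2(1), where a=a and b=b, folded w_def[abs_def]] by auto
  have f: "f \<in> D" "\<And>x. x \<ge> l \<Longrightarrow> D1 l f x = 1 * D1 l y x + (-1) * D1 l w x"
    using Dstar_linear[OF assms w(1), where a=1 and b="-1", folded f_def[abs_def]] by auto
  show ?thesis
  proof (rule that[OF f(1)])
    show "f l = 0" using c1(2) c2(2) by (simp add: f_def w_def a_def b_def)
    show "D1 l f l = 0" using f(2)[of l] w(2)[of l] c1(3) c2(3) by (simp add: a_def b_def)
    fix x assume x: "x > l + 1"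
    then have "x \<ge> l" by simp
    then show "f x = y x \<and> D1 l f x = D1 l y x"
      using f(2)[of x] w(2)[of x] c1(4)[of x] c2(4)[of x] x by (simp add: f_def w_def)
  qed
qed

text \<open>The bracket at infinity sees only the tail of \<open>y\<close>, which is also the tail of an element \<open>f\<close> of the minimal
  domain. For \<open>f\<close> the form \<open>(l(f), f)\<close> is real and the boundary data vanish, so the bracket tends to zero.\<close>

lemma green_diagonal:
  assumes y: "y \<in> D"
  shows "ip l (L y) y - ip l y (L y) = bracket l y y l"
proof -
  obtain f where f: "f \<in> D" "f l = 0" "D1 l f l = 0"
    "\<And>x. x > l + 1 \<Longrightarrow> f x = y x \<and> D1 l f x = D1 l y x"
    using modify_near_endpoint[OF y] by blast
  have "ip l (L f) f \<in> \<real>\<^sub>\<ge>\<^sub>0"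
    using nonneg f(1-3) by (auto simp: nonnegative_op_def min_op_def)
  then have "ip l (L f) f = ip l f (L f)"
    by (subst (2) ip_cnj) (auto simp: complex_nonneg_Reals_iff complex_eq_iff)
  then have "(\<lambda>n. bracket l f f (l + real n)) \<longlonglongrightarrow> 0"
    using bracket_tendsto[OF f(1) f(1)] f(2,3) by (simp add: bracket_def)
  moreover have "\<forall>\<^sub>F n in sequentially. bracket l f f (l + real n) = bracket l y y (l + real n)"
    unfolding eventually_sequentially
    by (intro exI[of _ 2]) (auto simp: bracket_def f(4))
  ultimately have "(\<lambda>n. bracket l y y (l + real n)) \<longlonglongrightarrow> 0"
    by (rule Lim_transform_eventually)
  from LIMSEQ_unique[OF this bracket_tendsto[OF y y]] show ?thesis by simp
qed

text \<open>After a formal integration by parts this is \<open>\<integral> y' * cnj z' + q * y * cnj z\<close>: the energy form, freed from the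
  boundary condition at the endpoint.\<close>

definition form :: "fn \<Rightarrow> fn \<Rightarrow> complex" where
  "form y z = ip l (L y) z - D1 l y l * cnj (z l)"

text \<open>The same form with the differential expression moved to the second argument; Green's formula says that the
  two agree.\<close>

definition adjoint_form :: "fn \<Rightarrow> fn \<Rightarrow> complex" where
  "adjoint_form y z = ip l y (L z) - y l * cnj (D1 l z l)"

lemma adjoint_form_eq: "adjoint_form y z = cnj (form z y)"
  unfolding form_def adjoint_form_def by (subst ip_cnj) simp

lemma form_linear_left:
  assumes "y \<in> D" "z \<in> D" "f \<in> D"
  shows "form (\<lambda>x. a * y x + b * z x) f = a * form y f + b * form z f"
  using ip_sl_linear_left[OF assms(1,2) DstarD(2)[OF assms(3)], of a b]
    Dstar_linear(2)[OF assms(1,2) order_refl, of a b]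
  by (simp add: form_def algebra_simps)

lemma form_linear_right:
  assumes "y \<in> D" "z \<in> D" "f \<in> D"
  shows "form f (\<lambda>x. a * y x + b * z x) = cnj a * form f y + cnj b * form f z"
  using ip_linear_right[OF DstarD(2)[OF assms(1)] DstarD(2)[OF assms(2)] DstarD(4)[OF assms(3)], of a b]
  by (simp add: form_def algebra_simps)

text \<open>Polarisation of Green's formula on the diagonal.\<close>

lemma form_hermitian:
  assumes "y \<in> D" "z \<in> D"
  shows "form z y = cnj (form y z)"
proof -
  define e where "e y z = form y z - cnj (form z y)" for y z
  have e0: "e y y = 0" if "y \<in> D" for y
    using green_diagonal[OF that] 
    by (simp add: e_def flip: adjoint_form_eq) (simp add: form_def adjoint_form_def bracket_def algebra_simps)
  have exp: "e (\<lambda>x. 1 * y x + b * z x) (\<lambda>x. 1 * y x + b * z x)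
    = e y y + cnj b * e y z + b * e z y + b * cnj b * e z z" for b
  proof -
    note w = Dstar_linear(1)[OF assms, of 1 b]
    show ?thesis
      unfolding e_def form_linear_left[OF assms w]
      unfolding form_linear_right[OF assms assms(1)] form_linear_right[OF assms assms(2)]
      by (simp add: algebra_simps)
  qed
  have "e y z + e z y = 0" 
    using exp[of 1] e0[OF Dstar_linear(1)[OF assms, of 1 1]] e0[OF assms(1)] e0[OF assms(2)] by simp
  moreover have "- \<i> * e y z + \<i> * e z y = 0"
    using exp[of \<i>] e0[OF Dstar_linear(1)[OF assms, of 1 \<i>]] e0[OF assms(1)] e0[OF assms(2)] by simp
  ultimately have "e z y = 0" by (simp add: complex_eq_iff)
  then show ?thesis by (simp add: e_def)
qed

lemma form_eq_adjoint_form: "y \<in> D \<Longrightarrow> z \<in> D \<Longrightarrow> form y z = adjoint_form y z"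
  using form_hermitian[of z y] adjoint_form_eq[of y z] by simp

lemma green:
  assumes "y \<in> D" "z \<in> D"
  shows "ip l (L y) z - ip l y (L z) = D1 l y l * cnj (z l) - y l * cnj (D1 l z l)"
  using form_eq_adjoint_form[OF assms] by (simp add: form_def adjoint_form_def algebra_simps)

lemma form_self_real:
  assumes "y \<in> D"
  shows "Im (form y y) = 0"
  using arg_cong[OF form_hermitian[OF assms assms], of Im] by simp

lemma form_expand:
  assumes "y \<in> D" "z \<in> D"
  shows "form (\<lambda>x. 1 * y x + b * z x) (\<lambda>x. 1 * y x + b * z x)
    = form y y + cnj b * form y z + b * cnj (form y z) + b * cnj b * form z z"
proof -
  note w = Dstar_linear(1)[OF assms, of 1 b]
  show ?thesis
    unfolding form_linear_left[OF assms w] 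
    unfolding form_linear_right[OF assms assms(1)] form_linear_right[OF assms assms(2)]
    using form_hermitian[OF assms] by (simp add: algebra_simps)
qed

text \<open>The layers approximate zero in energy although their derivative at the endpoint is one: the boundary
  value of the derivative is not controlled by the energy form.\<close>

lemma boundary_layer_sequence:
  obtains g :: "nat \<Rightarrow> fn" where "\<And>n. g n \<in> D" "\<And>n. g n l = 0" "\<And>n. D1 l (g n) l = 1"
    "(\<lambda>n. form (g n) (g n)) \<longlonglongrightarrow> 0" "\<And>y. y \<in> D \<Longrightarrow> (\<lambda>n. form (g n) y) \<longlonglongrightarrow> 0"
proof -
  obtain \<phi> where s: "sl_solution l q (- 1) 0 1 \<phi>" using fundamental_solutions by blast
  define g where "g n = truncation l (real (Suc n)) \<phi>" for n
  have pos: "0 < real (Suc n)" "1 \<le> real (Suc n)" for n by auto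
  note c = truncation_Dstar[OF s pos(1), folded g_def]
  obtain M where M: "\<And>k. k \<ge> 1 \<Longrightarrow> cmod (ip l (L (truncation l k \<phi>)) (truncation l k \<phi>)) \<le> M / k"
    "\<And>k F. k \<ge> 1 \<Longrightarrow> L2 l F \<Longrightarrow> cmod (ip l (truncation l k \<phi>) F) \<le> M / k * (1 + Re (ip l F F))"
    using boundary_layer[OF s] by blast
  have lim: "(\<lambda>n. M / real (Suc n) * K) \<longlonglongrightarrow> 0" for K
    using tendsto_mult[OF tendsto_mult[OF tendsto_const[of M] LIMSEQ_inverse_real_of_nat] tendsto_const[of K]]
    by (simp add: divide_inverse)
  show ?thesis
  proof (rule that[of g])
    show "g n \<in> D" "g n l = 0" "D1 l (g n) l = 1" for n
      using c(1-3)[of n] by auto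
    have "form (g n) (g n) = ip l (L (g n)) (g n)" for n using c(2) by (simp add: form_def)
    then show "(\<lambda>n. form (g n) (g n)) \<longlonglongrightarrow> 0"
      using M(1)[OF pos(2)] by (intro Lim_null_comparison[OF _ lim[of 1]]) (auto simp: g_def)
    fix y assume y: "y \<in> D"
    have "form (g n) y = ip l (g n) (L y)" for n
      using form_eq_adjoint_form[OF c(1) y] c(2) by (simp add: adjoint_form_def)
    then show "(\<lambda>n. form (g n) y) \<longlonglongrightarrow> 0"
      using M(2)[OF pos(2) DstarD(4)[OF y]]
      by (intro Lim_null_comparison[OF _ lim[of "1 + Re (ip l (L y) (L y))"]]) (auto simp: g_def)
  qed
qed

lemma form_layer_limit:
  assumes "y \<in> D" "\<And>n. g n \<in> D" "(\<lambda>n. form (g n) (g n)) \<longlonglongrightarrow> 0" "(\<lambda>n. form (g n) y) \<longlonglongrightarrow> 0"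
  shows "(\<lambda>n. form (\<lambda>x. 1 * y x + b * g n x) (\<lambda>x. 1 * y x + b * g n x)) \<longlonglongrightarrow> form y y"
proof -
  have "(\<lambda>n. form y y + cnj b * cnj (form (g n) y) + b * form (g n) y + b * cnj b * form (g n) (g n))
     \<longlonglongrightarrow> form y y + cnj b * cnj 0 + b * 0 + b * cnj b * 0"
    by (intro tendsto_intros assms)
  moreover have "form (\<lambda>x. 1 * y x + b * g n x) (\<lambda>x. 1 * y x + b * g n x)
     = form y y + cnj b * cnj (form (g n) y) + b * form (g n) y + b * cnj b * form (g n) (g n)" for n
    using form_expand[OF assms(1,2), of b n] form_hermitian[OF assms(1) assms(2), of n] by simp
  ultimately show ?thesis by simp
qed

text \<open>Nonnegativity passes from the minimal operator to all functions that vanish at the endpoint (the Friedrichs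
  extension has the Dirichlet condition): boundary layers correct the derivative at no cost in energy.\<close>

lemma dirichlet_form_nonneg:
  assumes f: "f \<in> D" "f l = 0"
  shows "Re (form f f) \<ge> 0"
proof -
  obtain g where g: "\<And>n. g n \<in> D" "\<And>n. g n l = 0" "\<And>n. D1 l (g n) l = 1"
    "(\<lambda>n. form (g n) (g n)) \<longlonglongrightarrow> 0" "\<And>y. y \<in> D \<Longrightarrow> (\<lambda>n. form (g n) y) \<longlonglongrightarrow> 0"
    using boundary_layer_sequence by blast
  define b where "b = - D1 l f l"
  define w where "w n = (\<lambda>x. 1 * f x + b * g n x)" for n
  have w: "w n \<in> D" "w n l = 0" "D1 l (w n) l = 0" for n
    using Dstar_linear[OF f(1) g(1)[of n], where a=1 and b=b, folded w_def] f(2) g(2,3)[of n]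
    by (auto simp: w_def b_def)
  have "Re (form (w n) (w n)) \<ge> 0" for n
    using nonneg w[of n] by (auto simp: form_def nonnegative_op_def min_op_def complex_nonneg_Reals_iff)
  moreover have "(\<lambda>n. Re (form (w n) (w n))) \<longlonglongrightarrow> Re (form f f)"
    unfolding w_def by (intro tendsto_Re form_layer_limit f g)
  ultimately show ?thesis by (intro LIMSEQ_le_const) auto
qed

section \<open>Weyl solutions and the sharp lower bound of the boundary form\<close>

text \<open>The action on the Weyl solution is recorded through inner products, which absorbs the null set
  where the differential equation may fail.\<close>

lemma weyl_solution:
  assumes "z \<notin> \<real>\<^sub>\<ge>\<^sub>0"
  obtains \<psi> where "\<psi> \<in> D" "\<psi> l = -1" "D1 l \<psi> l = m_inf z"
    "\<And>f. L2 l f \<Longrightarrow> ip l (L \<psi>) f = z * ip l \<psi> f"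
proof -
  obtain \<phi>1 \<phi>2 where s: "sl_solution l q z 0 1 \<phi>1" "sl_solution l q z (- 1) 0 \<phi>2"
    and L2: "L2 l (\<lambda>x. \<phi>2 x + m_inf z * \<phi>1 x)"
    using weyl assms unfolding weyl_function_def by blast
  obtain r1 where p1: "sl_pair l \<phi>1 (D1 l \<phi>1) r1"
    and r1: "AE x in lebesgue_on {l..}. - r1 x + of_real (q x) * \<phi>1 x = z * \<phi>1 x"
    using sl_solution_pair[OF s(1)] .
  obtain r2 where p2: "sl_pair l \<phi>2 (D1 l \<phi>2) r2"
    and r2: "AE x in lebesgue_on {l..}. - r2 x + of_real (q x) * \<phi>2 x = z * \<phi>2 x"
    using sl_solution_pair[OF s(2)] .
  define \<psi> where "\<psi> x = (if x < l then 0 else \<phi>2 x + m_inf z * \<phi>1 x)" for x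
  have p: "sl_pair l \<psi> (\<lambda>x. 1 * D1 l \<phi>2 x + m_inf z * D1 l \<phi>1 x) (\<lambda>x. 1 * r2 x + m_inf z * r1 x)"
    by (rule sl_pair_cong[OF sl_pair_linear[OF p2 p1]]) (simp add: \<psi>_def)
  have ge: "AE x in lebesgue_on {l..}. x \<ge> l" by (intro AE_I2) auto
  have "AE x in lebesgue_on {l..}. \<phi>2 x + m_inf z * \<phi>1 x = \<psi> x"
    using ge by eventually_elim (simp add: \<psi>_def)
  then have L2\<psi>: "L2 l \<psi>" by (rule L2_cong_AE[OF L2])
  have L2z: "L2 l (\<lambda>x. z * \<psi> x)" using L2_linear[OF L2\<psi> L2\<psi>, of z 0] by simp
  have ae: "AE x in lebesgue_on {l..}. - (1 * r2 x + m_inf z * r1 x) + of_real (q x) * \<psi> x = z * \<psi> x"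
    using r1 r2 ge
  proof eventually_elim
    case (elim x)
    have "- (1 * r2 x + m_inf z * r1 x) + of_real (q x) * \<psi> x
      = (- r2 x + of_real (q x) * \<phi>2 x) + m_inf z * (- r1 x + of_real (q x) * \<phi>1 x)"
      using elim(3) by (simp add: \<psi>_def algebra_simps)
    then show ?case unfolding elim(1,2) using elim(3) by (simp add: \<psi>_def algebra_simps)
  qed
  have nz: "\<psi> x = 0" if "x < l" for x using that by (simp add: \<psi>_def)
  note res = Dstar_pairI[OF p nz L2\<psi> L2z ae]
  show ?thesis
  proof (rule that)
    show D: "\<psi> \<in> D" using res(1) by blast
    show "\<psi> l = -1" using s by (simp add: \<psi>_def sl_solution_def)
    show "D1 l \<psi> l = m_inf z" using res(2)[of l] s by (simp add: sl_solution_def)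
    fix f assume f: "L2 l f"
    have "ip l (L \<psi>) f = ip l (\<lambda>x. z * \<psi> x) f"
      using res(3) by (intro ip_cong_AE_left[OF DstarD(4)[OF D] _ f]) auto
    also have "\<dots> = z * ip l \<psi> f" using ip_linear_left[OF L2\<psi> L2\<psi> f, of z 0] by simp
    finally show "ip l (L \<psi>) f = z * ip l \<psi> f" .
  qed
qed

text \<open>For \<open>t < 0\<close> split \<open>y\<close> into a multiple of the Weyl solution at \<open>t\<close> and a function vanishing at the endpoint.
  The two parts are orthogonal for the form shifted by \<open>t\<close>. On the Weyl solution, normalised to the value
  \<open>-1\<close>, the shifted form equals \<open>m_inf t\<close>; on the other part it is nonnegative.\<close>

lemma form_lower_bound_shifted:
  assumes y: "y \<in> D" and t: "t < 0"
  shows "Re (m_inf (of_real t)) * (cmod (y l))\<^sup>2 \<le> Re (form y y) - t * Re (ip l y y)"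
proof -
  have "complex_of_real t \<notin> \<real>\<^sub>\<ge>\<^sub>0" using t by (simp add: complex_nonneg_Reals_iff)
  then obtain \<psi> where \<psi>: "\<psi> \<in> D" "\<psi> l = -1" "D1 l \<psi> l = m_inf (of_real t)"
    "\<And>f. L2 l f \<Longrightarrow> ip l (L \<psi>) f = of_real t * ip l \<psi> f"
    using weyl_solution by blast
  define c where "c = - y l"
  define f where "f x = 1 * y x + (- c) * \<psi> x" for x
  have f: "f \<in> D" "f l = 0"
    using Dstar_linear(1)[OF y \<psi>(1), where a=1 and b="- c", folded f_def[abs_def]] \<psi>(2) by (auto simp: f_def c_def)
  have y_eq: "y = (\<lambda>x. 1 * f x + c * \<psi> x)" by (auto simp: f_def)
  have ff: "form \<psi> f = of_real t * ip l \<psi> f" "form \<psi> \<psi> = of_real t * ip l \<psi> \<psi> + m_inf (of_real t)"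
    using \<psi> f DstarD(2) by (auto simp: form_def)
  have "form y y = form f f + cnj c * form f \<psi> + c * cnj (form f \<psi>) + c * cnj c * form \<psi> \<psi>"
    unfolding y_eq using form_expand[OF f(1) \<psi>(1), of c] .
  also have "form f \<psi> = of_real t * ip l f \<psi>"
    using form_hermitian[OF \<psi>(1) f(1)] ff(1) ip_cnj[of l f \<psi>] by simp
  finally have 1: "form y y = form f f + of_real t * (cnj c * ip l f \<psi> + c * ip l \<psi> f + c * cnj c * ip l \<psi> \<psi>)
      + c * cnj c * m_inf (of_real t)"
    unfolding ff using ip_cnj[of l \<psi> f] by (simp add: algebra_simps)
  have L2s: "L2 l f" "L2 l \<psi>" "L2 l y" using f \<psi> y DstarD(2) by blast+
  have "ip l y y = ip l f f + (cnj c * ip l f \<psi> + c * ip l \<psi> f + c * cnj c * ip l \<psi> \<psi>)"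
  proof -
    have "ip l y y = 1 * ip l f y + c * ip l \<psi> y"
      by (subst y_eq) (rule ip_linear_left[OF L2s])
    moreover have "ip l f y = cnj 1 * ip l f f + cnj c * ip l f \<psi>"
      by (subst y_eq) (rule ip_linear_right[OF L2s(1,2,1)])
    moreover have "ip l \<psi> y = cnj 1 * ip l \<psi> f + cnj c * ip l \<psi> \<psi>"
      by (subst y_eq) (rule ip_linear_right[OF L2s(1,2,2)])
    ultimately show ?thesis by (simp add: algebra_simps)
  qed
  with 1 have "form y y - of_real t * ip l y y = form f f - of_real t * ip l f f + c * cnj c * m_inf (of_real t)"
    by (simp add: algebra_simps)
  then have "form y y - of_real t * ip l y y
      = form f f - of_real t * ip l f f + of_real ((cmod (y l))\<^sup>2) * m_inf (of_real t)"
    by (simp add: c_def complex_norm_square flip: of_real_power)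
  then have "Re (form y y) - t * Re (ip l y y)
      = Re (form f f) - t * Re (ip l f f) + (cmod (y l))\<^sup>2 * Re (m_inf (of_real t))"
    by (simp add: complex_eq_iff)
  moreover have "- t * Re (ip l f f) \<ge> 0" using t ip_self_nonneg[of l f] by (simp add: mult_le_0_iff)
  ultimately show ?thesis using dirichlet_form_nonneg[OF f] by (simp add: mult.commute)
qed

end

text \<open>Now the limit of the Weyl function at zero from the left is available; it will turn out to be the exact
  lower bound of the boundary form relative to \<open>\<bar>y(l)\<bar>\<^sup>2\<close>, on the domain of every \<open>T\<^sub>h\<close>.\<close>

locale nonneg_schroedinger_limit = nonneg_schroedinger +
  fixes m :: real
  assumes m_lim: "((\<lambda>t. m_inf (complex_of_real t)) \<longlongrightarrow> complex_of_real m) (at_left 0)"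
begin

lemma form_lower_bound:
  assumes y: "y \<in> D"
  shows "m * (cmod (y l))\<^sup>2 \<le> Re (form y y)"
proof (rule tendsto_le[of "at_left (0::real)"])
  show "((\<lambda>t. Re (form y y) - t * Re (ip l y y)) \<longlongrightarrow> Re (form y y)) (at_left 0)"
    by (auto intro!: tendsto_eq_intros)
  show "((\<lambda>t. Re (m_inf (of_real t)) * (cmod (y l))\<^sup>2) \<longlongrightarrow> m * (cmod (y l))\<^sup>2) (at_left 0)"
    using tendsto_Re[OF m_lim] by (intro tendsto_mult tendsto_const) simp
  show "\<forall>\<^sub>F t in at_left 0. Re (m_inf (of_real t)) * (cmod (y l))\<^sup>2 \<le> Re (form y y) - t * Re (ip l y y)"
    using form_lower_bound_shifted[OF y] by (auto simp: eventually_at_filter intro!: always_eventually)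
qed simp

text \<open>The Weyl solution at \<open>t\<close> close to zero has energy at most \<open>m_inf t\<close>, and a boundary layer bends it into the
  domain of \<open>T\<^sub>h\<close>. So the bound is sharp on each of these domains, whatever \<open>h\<close> is.\<close>

lemma form_lower_bound_sharp:
  assumes "e > 0"
  obtains y where "y \<in> D" "D1 l y l = h * y l" "cmod (y l) = 1" "Re (form y y) < m + e"
proof -
  have "\<forall>\<^sub>F t in at_left 0. Re (m_inf (complex_of_real t)) < m + e"
    using order_tendstoD(2)[OF tendsto_Re[OF m_lim], of "m + e"] assms by simp
  moreover have "\<forall>\<^sub>F t in at_left (0::real). t < 0" by (auto simp: eventually_at_filter)
  ultimately have "\<forall>\<^sub>F t in at_left (0::real). t < 0 \<and> Re (m_inf (complex_of_real t)) < m + e"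
    by eventually_elim simp
  then obtain t where t: "t < 0" "Re (m_inf (complex_of_real t)) < m + e"
    using eventually_happens'[OF trivial_limit_at_left_real] by blast
  have "complex_of_real t \<notin> \<real>\<^sub>\<ge>\<^sub>0" using t by (simp add: complex_nonneg_Reals_iff)
  then obtain \<psi> where \<psi>: "\<psi> \<in> D" "\<psi> l = -1" "D1 l \<psi> l = m_inf (of_real t)"
    "\<And>f. L2 l f \<Longrightarrow> ip l (L \<psi>) f = of_real t * ip l \<psi> f"
    using weyl_solution by blast
  have "form \<psi> \<psi> = of_real t * ip l \<psi> \<psi> + m_inf (of_real t)"
    using \<psi> DstarD(2) by (auto simp: form_def)
  then have "Re (form \<psi> \<psi>) = t * Re (ip l \<psi> \<psi>) + Re (m_inf (of_real t))" by simp
  also have "\<dots> < m + e"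
    using t ip_self_nonneg[of l \<psi>] mult_nonpos_nonneg[of t "Re (ip l \<psi> \<psi>)"] by linarith
  finally have lt: "Re (form \<psi> \<psi>) < m + e" .
  obtain g where g: "\<And>n. g n \<in> D" "\<And>n. g n l = 0" "\<And>n. D1 l (g n) l = 1"
    "(\<lambda>n. form (g n) (g n)) \<longlonglongrightarrow> 0" "\<And>y. y \<in> D \<Longrightarrow> (\<lambda>n. form (g n) y) \<longlonglongrightarrow> 0"
    using boundary_layer_sequence by blast
  \<comment> \<open>With \<open>\<psi>(l) = -1\<close> the boundary condition reads \<open>m_inf t + b = - h\<close>.\<close>
  define b where "b = - h - m_inf (of_real t)"
  define w where "w n = (\<lambda>x. 1 * \<psi> x + b * g n x)" for n
  have w: "w n \<in> D" "w n l = -1" "D1 l (w n) l = - h" for n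
    using Dstar_linear[OF \<psi>(1) g(1)[of n], where a=1 and b=b, folded w_def] \<psi>(2,3) g(2,3)[of n]
    by (auto simp: w_def b_def)
  have "(\<lambda>n. Re (form (w n) (w n))) \<longlonglongrightarrow> Re (form \<psi> \<psi>)"
    unfolding w_def by (intro tendsto_Re form_layer_limit \<psi>(1) g)
  from order_tendstoD(2)[OF this lt]
  obtain n where "Re (form (w n) (w n)) < m + e" by (auto simp: eventually_sequentially)
  then show ?thesis using that[of "w n"] w[of n] by auto
qed

lemma T_op_quadratic_form:
  assumes "y \<in> fst (T_op l q h)"
  shows "y \<in> D" "D1 l y l = h * y l"
    "Re (ip l (snd (T_op l q h) y) y) = Re (form y y) + Re h * (cmod (y l))\<^sup>2"
    "Im (ip l (snd (T_op l q h) y) y) = Im h * (cmod (y l))\<^sup>2"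
proof -
  show y: "y \<in> D" "D1 l y l = h * y l" using assms by (auto simp: T_op_def)
  have "ip l (L y) y = form y y + h * (y l * cnj (y l))" using y by (simp add: form_def)
  then have "ip l (L y) y = form y y + h * of_real ((cmod (y l))\<^sup>2)"
    by (simp only: complex_norm_square)
  then show "Re (ip l (snd (T_op l q h) y) y) = Re (form y y) + Re h * (cmod (y l))\<^sup>2"
    "Im (ip l (snd (T_op l q h) y) y) = Im h * (cmod (y l))\<^sup>2"
    using form_self_real[OF y(1)] by (simp_all add: T_op_def del: of_real_power)
qed

text \<open>On the domain of \<open>T\<^sub>h\<close> the imaginary part of \<open>(T\<^sub>h y, y)\<close> is \<open>Im h * \<bar>y(l)\<bar>\<^sup>2\<close> and the real part is at least
  \<open>(Re h + m) * \<bar>y(l)\<bar>\<^sup>2\<close>, with the factor sharp. Hence the exact angle has tangent \<open>Im h / (Re h + m)\<close>.\<close>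

lemma sectorial_iff:
  assumes h: "Im h > 0" and \<beta>: "0 < \<beta>" "\<beta> < pi / 2"
  shows "sectorial l (T_op l q h) \<beta> \<longleftrightarrow> Re h + m > 0 \<and> tan \<beta> = Im h / (Re h + m)"
proof -
  let ?T = "T_op l q h"
  define R I where "R y = Re (ip l (snd ?T y) y)" and "I y = Im (ip l (snd ?T y) y)" for y
  define d where "d = Re h + m"
  have tan: "tan \<beta> > 0" using \<beta> by (intro tan_gt_zero) auto
  have cot: "cot \<beta> = 1 / tan \<beta>" by (simp add: cot_def tan_def)
  have RI: "R y \<ge> d * (cmod (y l))\<^sup>2" "\<bar>I y\<bar> = Im h * (cmod (y l))\<^sup>2" if "y \<in> fst ?T" for y
    using T_op_quadratic_form[OF that] form_lower_bound[of y] h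
    by (auto simp: R_def I_def d_def abs_mult algebra_simps)
  \<comment> \<open>A minimising function is normalised by \<open>\<bar>y(l)\<bar> = 1\<close>, so its imaginary part is \<open>Im h\<close> exactly.\<close>
  have sharp: "\<exists>y \<in> fst ?T. R y < d + e \<and> \<bar>I y\<bar> = Im h" if "e > 0" for e
  proof -
    obtain y where y: "y \<in> D" "D1 l y l = h * y l" "cmod (y l) = 1" "Re (form y y) < m + e"
      using form_lower_bound_sharp[OF \<open>e > 0\<close>, of h] by blast
    then have yT: "y \<in> fst ?T" by (simp add: T_op_def)
    then show ?thesis
      using T_op_quadratic_form[OF yT] y RI(2)[OF yT] by (intro bexI[of _ y]) (auto simp: R_def d_def)
  qed
  have SUP: "(SUP y \<in> fst ?T. \<bar>I y\<bar> / R y) = Im h / d" if d: "d > 0"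
  proof -
    have le: "\<bar>I y\<bar> / R y \<le> Im h / d" if "y \<in> fst ?T" for y
    proof (cases "y l = 0")
      case True
      then show ?thesis using RI(2)[OF that] h d by simp
    next
      case False
      then have c: "(cmod (y l))\<^sup>2 > 0" by simp
      then have "R y > 0" using RI(1)[OF that] d by (meson less_le_trans mult_pos_pos)
      moreover have "Im h * (cmod (y l))\<^sup>2 * d \<le> Im h * R y"
        using RI(1)[OF that] h by (simp add: mult.assoc mult.commute[of _ d])
      ultimately show ?thesis using RI(2)[OF that] d by (simp add: field_simps)
    qed
    have bdd: "bdd_above ((\<lambda>y. \<bar>I y\<bar> / R y) ` fst ?T)" by (rule bdd_aboveI2[OF le])
    have ne: "fst ?T \<noteq> {}" using sharp[of 1] by auto
    let ?S = "SUP y \<in> fst ?T. \<bar>I y\<bar> / R y"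
    have lower: "Im h / (d + e) < ?S" if e: "e > 0" for e
    proof -
      obtain y where y: "y \<in> fst ?T" "R y < d + e" "\<bar>I y\<bar> = Im h" using sharp[OF e] by blast
      have "R y > 0"
      proof -
        have "(cmod (y l))\<^sup>2 = 1" using RI(2)[OF y(1)] y(3) h by simp
        then show ?thesis using RI(1)[OF y(1)] d by simp
      qed
      then have "Im h / (d + e) < \<bar>I y\<bar> / R y"
        unfolding y(3) using y(2) h by (intro divide_strict_left_mono) auto
      also have "\<dots> \<le> ?S" using cSUP_upper[OF y(1) bdd] .
      finally show ?thesis .
    qed
    show ?thesis
    proof (rule antisym)
      show "?S \<le> Im h / d" using le by (intro cSUP_least ne)
      show "Im h / d \<le> ?S"
      proof (rule ccontr)
        assume "\<not> Im h / d \<le> ?S"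
        then have lt: "?S < Im h / d" by simp
        have "0 < Im h / (d + 1)" using h d by simp
        then have S: "?S > 0" using lower[of 1] by linarith
        then have "Im h / ?S - d > 0" using lt d by (simp add: field_simps)
        \<comment> \<open>The choice of \<open>e\<close> makes the strict lower bound equal to the supremum itself.\<close>
        from lower[OF this] show False using h S by simp
      qed
    qed
  qed
  have sect: "sectorial l ?T \<beta> \<longleftrightarrow> (\<forall>y\<in>fst ?T. R y \<ge> 0) \<and> (\<forall>y\<in>fst ?T. cot \<beta> * \<bar>I y\<bar> \<le> R y)
     \<and> tan \<beta> = (SUP y \<in> fst ?T. \<bar>I y\<bar> / R y)"
    by (simp add: sectorial_def accretive_def R_def I_def)
  show ?thesis
  proof
    assume "sectorial l ?T \<beta>"
    then have s: "\<forall>y\<in>fst ?T. cot \<beta> * \<bar>I y\<bar> \<le> R y" "tan \<beta> = (SUP y \<in> fst ?T. \<bar>I y\<bar> / R y)"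
      using sect by auto
    have "cot \<beta> * Im h \<le> d"
    proof (rule field_le_epsilon)
      fix e :: real assume "e > 0"
      from sharp[OF this] s(1) show "cot \<beta> * Im h \<le> d + e" by force
    qed
    moreover have "cot \<beta> * Im h > 0" using tan h by (simp add: cot)
    ultimately have "d > 0" by linarith
    with SUP s(2) show "Re h + m > 0 \<and> tan \<beta> = Im h / (Re h + m)" by (simp add: d_def)
  next
    assume "Re h + m > 0 \<and> tan \<beta> = Im h / (Re h + m)"
    then have d: "d > 0" "tan \<beta> = Im h / d" by (auto simp: d_def)
    then have cd: "cot \<beta> * Im h = d" using h by (simp add: cot)
    have "cot \<beta> * \<bar>I y\<bar> \<le> R y \<and> R y \<ge> 0" if "y \<in> fst ?T" for y
    proof -
      have "cot \<beta> * \<bar>I y\<bar> = d * (cmod (y l))\<^sup>2" using RI(2)[OF that] cd by (simp flip: mult.assoc)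
      moreover have "d * (cmod (y l))\<^sup>2 \<ge> 0" using d by simp
      ultimately show ?thesis using RI(1)[OF that] by linarith
    qed
    then show "sectorial l ?T \<beta>" using SUP[OF d(1)] d(2) sect by auto
  qed
qed

end

section \<open>The transfer function\<close>

context nonneg_schroedinger
begin

lemma Dstar_eq_zero:
  assumes "y \<in> D" "Re (ip l y y) = 0"
  shows "y x = 0"
proof (cases "x < l")
  case True
  then show ?thesis using DstarD(1) assms(1) by blast
next
  case False
  have "continuous_on {l..} y"
    using sl_pair_continuous(1)[OF sl_regular_pair[OF DstarD(3)[OF assms(1)]]] .
  then show ?thesis
    using AE_zero_continuous_imp_zero[OF ip_self_eq_0[OF DstarD(2)[OF assms(1)] assms(2)]] False by simp
qed

lemma i_not_nonneg: "\<i> \<notin> \<real>\<^sub>\<ge>\<^sub>0" "- \<i> \<notin> \<real>\<^sub>\<ge>\<^sub>0"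
  by (auto simp: complex_nonneg_Reals_iff)

text \<open>Green's formula for the Weyl solutions at \<open>- \<i>\<close> and \<open>\<i>\<close>: the two inner products cancel, so the boundary terms
  do as well.\<close>

lemma weyl_function_cnj_i: "m_inf (- \<i>) = cnj (m_inf \<i>)"
proof -
  obtain \<psi> where \<psi>: "\<psi> \<in> D" "\<psi> l = -1" "D1 l \<psi> l = m_inf \<i>"
    "\<And>f. L2 l f \<Longrightarrow> ip l (L \<psi>) f = \<i> * ip l \<psi> f"
    using weyl_solution[OF i_not_nonneg(1)] by blast
  obtain \<eta> where \<eta>: "\<eta> \<in> D" "\<eta> l = -1" "D1 l \<eta> l = m_inf (- \<i>)"
    "\<And>f. L2 l f \<Longrightarrow> ip l (L \<eta>) f = - \<i> * ip l \<eta> f"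
    using weyl_solution[OF i_not_nonneg(2)] by blast
  have "ip l (L \<eta>) \<psi> = - \<i> * ip l \<eta> \<psi>" using \<eta>(4) DstarD(2)[OF \<psi>(1)] by blast
  moreover have "ip l \<eta> (L \<psi>) = - \<i> * ip l \<eta> \<psi>"
    using \<psi>(4)[OF DstarD(2)[OF \<eta>(1)]] by (subst (1 2) ip_cnj) simp
  ultimately show ?thesis using green[OF \<eta>(1) \<psi>(1)] \<psi>(2,3) \<eta>(2,3) by simp
qed

text \<open>The form is real on the diagonal, so \<open>- Im (m_inf \<i>)\<close> is the squared norm of the Weyl solution, which does not
  vanish at the endpoint.\<close>

lemma weyl_function_Im_i: "Im (m_inf \<i>) < 0"
proof -
  obtain \<psi> where \<psi>: "\<psi> \<in> D" "\<psi> l = -1" "D1 l \<psi> l = m_inf \<i>"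
    "\<And>f. L2 l f \<Longrightarrow> ip l (L \<psi>) f = \<i> * ip l \<psi> f"
    using weyl_solution[OF i_not_nonneg(1)] by blast
  have "ip l (L \<psi>) \<psi> = \<i> * ip l \<psi> \<psi>" using \<psi>(4) DstarD(2)[OF \<psi>(1)] by blast
  then have "form \<psi> \<psi> = \<i> * ip l \<psi> \<psi> + m_inf \<i>" using \<psi> by (simp add: form_def)
  then have "Re (ip l \<psi> \<psi>) = - Im (m_inf \<i>)"
    using form_self_real[OF \<psi>(1)] by simp
  moreover have "Re (ip l \<psi> \<psi>) \<noteq> 0" using Dstar_eq_zero[OF \<psi>(1), of l] \<psi>(2) by auto
  ultimately show ?thesis using ip_self_nonneg[of l \<psi>] by linarith
qed

text \<open>Finite and infinite \<open>\<mu>\<close> are treated together: the channel vector is a multiple of \<open>f \<mapsto> cnj (a f(l) + b f'(l))\<close>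
  with \<open>(a, b) = (\<mu>, -1)\<close> or \<open>(1, 0)\<close>.\<close>

definition boundary_form :: "real \<Rightarrow> real \<Rightarrow> fn \<Rightarrow> complex" where
  "boundary_form a b f = of_real a * f l + of_real b * D1 l f l"

text \<open>The relation \<open>Im A = K K\<^sup>*\<close> on boundary data \<open>u = y(l)\<close> and \<open>p = y'(l)\<close>. It makes the state-space operator
  dissipative up to a rank-one square, hence the resolvent equation at \<open>- \<i>\<close> uniquely solvable.\<close>

lemma boundary_identity:
  fixes h u p :: complex and a b :: real
  assumes "of_real a + of_real b * h \<noteq> 0"
  shows "Im (p * cnj u - 1 / (of_real a + of_real b * h) * (p - h * u) * cnj (of_real a * u + of_real b * p))
    = Im h * (cmod (of_real a * u + of_real b * p) / cmod (of_real a + of_real b * h))\<^sup>2"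
proof -
  define w where "w = of_real a + of_real b * h"
  define X where "X = p * cnj u - 1 / w * (p - h * u) * cnj (of_real a * u + of_real b * p)"
  have w: "w \<noteq> 0" using assms by (simp add: w_def)
  have c: "(cmod w)\<^sup>2 > 0" using w by simp
  have "X * w = p * cnj u * w - (p - h * u) * cnj (of_real a * u + of_real b * p)"
    using w by (simp add: X_def field_simps)
  then have "X * (w * cnj w) = (p * cnj u * w - (p - h * u) * cnj (of_real a * u + of_real b * p)) * cnj w"
    by (simp flip: mult.assoc)
  then have "Im (X * of_real ((cmod w)\<^sup>2)) = Im ((p * cnj u * w - (p - h * u) * cnj (of_real a * u + of_real b * p)) * cnj w)"
    by (simp only: complex_norm_square)
  also have "\<dots> = Im h * (cmod (of_real a * u + of_real b * p))\<^sup>2"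
    unfolding cmod_power2 w_def by simp (simp add: algebra_simps power2_eq_square)
  finally have "Im X * (cmod w)\<^sup>2 = Im h * (cmod (of_real a * u + of_real b * p))\<^sup>2" by simp
  then have "Im X = Im h * (cmod (of_real a * u + of_real b * p) / cmod w)\<^sup>2"
    using c by (simp add: power_divide eq_divide_eq)
  then show ?thesis by (simp only: X_def w_def)
qed

text \<open>The resolvent at \<open>- \<i>\<close> maps the channel vector to a multiple of the Weyl solution, since on Weyl solutions
  the regular part \<open>l(y) + \<i> y\<close> vanishes and only the boundary functional remains. Testing the difference \<open>d\<close> of two
  solutions against itself gives \<open>\<bar>K\<^sup>* d\<bar>\<^sup>2 + \<parallel>d\<parallel>\<^sup>2 = 0\<close>, which is uniqueness.\<close>

lemma transfer_function_general:
  fixes a b :: real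
  assumes h: "Im h > 0" and ab: "of_real a + of_real b * h \<noteq> 0"
    and plus: "plus_space \<Theta> = D" and base: "base_ip \<Theta> = ip l"
    and state: "\<And>y f. state_op \<Theta> y f = ip l (L y) f
       - 1 / (of_real a + of_real b * h) * (D1 l y l - h * y l) * cnj (boundary_form a b f)"
    and channel: "\<And>f. channel_op \<Theta> 1 f =
       of_real (sqrt (Im h) / cmod (of_real a + of_real b * h)) * cnj (boundary_form a b f)"
  shows "transfer_function \<Theta> (- \<i>) = (of_real a + of_real b * h) / (of_real a + of_real b * cnj h)
    * ((m_inf (- \<i>) + cnj h) / (m_inf (- \<i>) + h))"
proof -
  define w where "w = m_inf (- \<i>)"
  define g where "g = of_real a + of_real b * h"
  define \<kappa> where "\<kappa> = complex_of_real (sqrt (Im h) / cmod g)"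
  obtain \<eta> where \<eta>: "\<eta> \<in> D" "\<eta> l = -1" "D1 l \<eta> l = w"
    "\<And>f. L2 l f \<Longrightarrow> ip l (L \<eta>) f = - \<i> * ip l \<eta> f"
    using weyl_solution[OF i_not_nonneg(2)] unfolding w_def by blast
  have "Im w > 0" using weyl_function_Im_i weyl_function_cnj_i by (simp add: w_def)
  then have wh: "w + h \<noteq> 0" using h by (auto simp: complex_eq_iff)
  have g: "g \<noteq> 0" using ab by (simp add: g_def)
  define c where "c = - \<kappa> * g / (w + h)"
  \<comment> \<open>Written as a combination of two elements to match the linearity lemmas.\<close>
  define y where "y x = c * \<eta> x + 0 * \<eta> x" for x
  note lin = Dstar_linear[OF \<eta>(1) \<eta>(1), where a=c and b=0, folded y_def[abs_def]]
  have y: "y \<in> D" "y l = - c" "D1 l y l = c * w"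
    using lin(1) lin(2)[of l] \<eta>(2,3) by (auto simp: y_def)
  define solves where "solves y \<longleftrightarrow> y \<in> plus_space \<Theta> \<and>
     (\<forall>f \<in> plus_space \<Theta>. state_op \<Theta> y f - (- \<i>) * base_ip \<Theta> y f = channel_op \<Theta> 1 f)" for y
  have "solves y"
    unfolding solves_def plus
  proof (intro conjI ballI y(1))
    fix f assume f: "f \<in> D"
    have L2s: "L2 l \<eta>" "L2 l f" using \<eta>(1) f DstarD(2) by blast+
    have "ip l (L y) f = c * (- \<i> * ip l \<eta> f)"
      using ip_sl_linear_left[OF \<eta>(1) \<eta>(1) L2s(2), of c 0, folded y_def[abs_def]] \<eta>(4)[OF L2s(2)] by simp
    moreover have "ip l y f = c * ip l \<eta> f"
      using ip_linear_left[OF L2s(1) L2s(1) L2s(2), of c 0, folded y_def[abs_def]] by simp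
    moreover have "1 / g * (D1 l y l - h * y l) = - \<kappa>"
    proof -
      have "D1 l y l - h * y l = c * (w + h)" using y(2,3) by (simp add: algebra_simps)
      also have "\<dots> = - \<kappa> * g" using wh by (simp add: c_def)
      finally show ?thesis using g by simp
    qed
    ultimately show "state_op \<Theta> y f - (- \<i>) * base_ip \<Theta> y f = channel_op \<Theta> 1 f"
      unfolding state base channel g_def[symmetric] \<kappa>_def[symmetric] by simp
  qed
  moreover have "y1 = y2" if "solves y1" "solves y2" for y1 y2
  proof -
    have D12: "y1 \<in> D" "y2 \<in> D" using that by (auto simp: solves_def plus)
    define d where "d x = 1 * y1 x + (-1) * y2 x" for x
    note lin = Dstar_linear[OF D12, where a=1 and b="-1", folded d_def[abs_def]]
    have d: "d \<in> D" "D1 l d l = D1 l y1 l - D1 l y2 l" "d l = y1 l - y2 l"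
      using lin(1) lin(2)[of l] by (auto simp: d_def)
    have L2d: "L2 l d" using d(1) DstarD(2) by blast
    define k N where "k = 1 / g" and "N = cnj (boundary_form a b d)"
    have "state_op \<Theta> y1 d - (- \<i>) * ip l y1 d = state_op \<Theta> y2 d - (- \<i>) * ip l y2 d"
      using that d(1) by (simp add: solves_def plus base)
    then have "ip l (L y1) d - k * (D1 l y1 l - h * y1 l) * N + \<i> * ip l y1 d
        = ip l (L y2) d - k * (D1 l y2 l - h * y2 l) * N + \<i> * ip l y2 d"
      unfolding state g_def[symmetric] k_def N_def by simp
    moreover have "ip l (L d) d = ip l (L y1) d - ip l (L y2) d"
      using ip_sl_linear_left[OF D12 L2d, of 1 "-1", folded d_def[abs_def]] by simp
    moreover have "ip l d d = ip l y1 d - ip l y2 d"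
      using ip_linear_left[OF DstarD(2)[OF D12(1)] DstarD(2)[OF D12(2)] L2d, of 1 "-1", folded d_def[abs_def]] by simp
    ultimately have "ip l (L d) d - k * (D1 l d l - h * d l) * N + \<i> * ip l d d = 0"
      unfolding d(2,3) by algebra
    then have z: "ip l (L d) d - 1 / g * (D1 l d l - h * d l) * cnj (boundary_form a b d) + \<i> * ip l d d = 0"
      unfolding k_def N_def .
    \<comment> \<open>Adding and subtracting the boundary term of the real form isolates the expression of the boundary identity.\<close>
    have "form d d + (D1 l d l * cnj (d l) - 1 / g * (D1 l d l - h * d l) * cnj (boundary_form a b d)) + \<i> * ip l d d = 0"
      using z by (simp add: form_def algebra_simps)
    then have "Im (form d d) + Im (D1 l d l * cnj (d l) - 1 / g * (D1 l d l - h * d l) * cnj (boundary_form a b d))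
        + Re (ip l d d) = 0"
      by (metis complex_i_mult_minus Im_i_times plus_complex.sel(2) zero_complex.sel(2))
    then have "Im h * (cmod (boundary_form a b d) / cmod g)\<^sup>2 + Re (ip l d d) = 0"
      using boundary_identity[OF ab, of "D1 l d l" "d l"] form_self_real[OF d(1)]
      unfolding boundary_form_def g_def by simp
    moreover have "Im h * (cmod (boundary_form a b d) / cmod g)\<^sup>2 \<ge> 0" using h by simp
    ultimately have "Re (ip l d d) = 0" using ip_self_nonneg[of l d] by linarith
    from Dstar_eq_zero[OF d(1) this] show ?thesis by (auto simp: d_def)
  qed
  ultimately have res: "state_resolvent \<Theta> (- \<i>) (channel_op \<Theta> 1) = y"
    unfolding state_resolvent_def solves_def[symmetric] by (intro the_equality) auto
  have "channel_adj \<Theta> y = \<kappa> * boundary_form a b y"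
    unfolding channel_adj_def channel g_def[symmetric] \<kappa>_def[symmetric] by (simp add: \<kappa>_def)
  also have "\<dots> = - \<kappa> * c * (of_real a - of_real b * w)"
    using y(2,3) by (simp add: boundary_form_def algebra_simps)
  finally have "transfer_function \<Theta> (- \<i>) = 1 - 2 * \<i> * (- \<kappa> * c * (of_real a - of_real b * w))"
    unfolding transfer_function_def res by simp
  also have "\<dots> = 1 - 2 * \<i> * \<kappa>\<^sup>2 * g * (of_real a - of_real b * w) / (w + h)"
    by (simp add: c_def power2_eq_square)
  also have "2 * \<i> * \<kappa>\<^sup>2 * g = (h - cnj h) / cnj g"
  proof -
    have "\<kappa>\<^sup>2 = of_real (Im h) / of_real ((cmod g)\<^sup>2)"
      using h by (simp add: \<kappa>_def power_divide flip: of_real_power)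
    also have "of_real ((cmod g)\<^sup>2) = g * cnj g" by (rule complex_norm_square)
    finally have "2 * \<i> * \<kappa>\<^sup>2 * g = 2 * \<i> * of_real (Im h) / cnj g" using g by (simp add: field_simps)
    also have "2 * \<i> * of_real (Im h) = h - cnj h" by (simp add: complex_eq_iff)
    finally show ?thesis .
  qed
  also have "1 - (h - cnj h) / cnj g * (of_real a - of_real b * w) / (w + h)
     = (cnj g * (w + h) - (h - cnj h) * (of_real a - of_real b * w)) / (cnj g * (w + h))"
  proof -
    have "1 - u / d * v / e = (d * e - u * v) / (d * e)" if "d \<noteq> 0" "e \<noteq> 0" for u v d e :: complex
      using that by (simp add: field_simps)
    then show ?thesis using g wh by simp
  qed
  also have "cnj g * (w + h) - (h - cnj h) * (of_real a - of_real b * w) = g * (w + cnj h)"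
    by (simp add: g_def algebra_simps)
  finally show ?thesis by (simp add: g_def w_def)
qed

text \<open>The factor containing \<open>\<mu>\<close> is a quotient of conjugate numbers, so the modulus, and with it the entropy, does
  not depend on \<open>\<mu>\<close>.\<close>

lemma cmod_transfer_function:
  assumes h: "Im h > 0"
  shows "cmod (transfer_function (schr_L_system l q \<mu> h) (- \<i>)) = cmod (m_inf \<i> + h) / cmod (m_inf \<i> + cnj h)"
proof -
  let ?\<Theta> = "schr_L_system l q \<mu> h"
  have "\<exists>a b. of_real a + of_real b * h \<noteq> 0 \<and>
    (\<forall>y f. state_op ?\<Theta> y f = ip l (L y) f
       - 1 / (of_real a + of_real b * h) * (D1 l y l - h * y l) * cnj (boundary_form a b f)) \<and>
    (\<forall>f. channel_op ?\<Theta> 1 f =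
       of_real (sqrt (Im h) / cmod (of_real a + of_real b * h)) * cnj (boundary_form a b f))"
  proof (cases \<mu>)
    case (Fin x)
    have "of_real x - h \<noteq> 0" using h by (auto simp: complex_eq_iff)
    then show ?thesis
      using Fin by (intro exI[of _ x] exI[of _ "-1"])
        (auto simp: schr_L_system_def boundary_form_def delta_def delta'_def)
  next
    case Infty
    then show ?thesis
      by (intro exI[of _ 1] exI[of _ 0]) (auto simp: schr_L_system_def boundary_form_def delta_def)
  qed
  then obtain a b where ab: "of_real a + of_real b * h \<noteq> 0"
    and s: "\<And>y f. state_op ?\<Theta> y f = ip l (L y) f
       - 1 / (of_real a + of_real b * h) * (D1 l y l - h * y l) * cnj (boundary_form a b f)"
    and c: "\<And>f. channel_op ?\<Theta> 1 f =
       of_real (sqrt (Im h) / cmod (of_real a + of_real b * h)) * cnj (boundary_form a b f)"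
    by blast
  have "transfer_function ?\<Theta> (- \<i>) = (of_real a + of_real b * h) / (of_real a + of_real b * cnj h)
    * ((m_inf (- \<i>) + cnj h) / (m_inf (- \<i>) + h))"
    by (rule transfer_function_general[OF h ab _ _ s c]) (simp_all add: schr_L_system_def)
  moreover have "cmod (of_real a + of_real b * cnj h) = cmod (of_real a + of_real b * h)"
    using complex_mod_cnj[of "of_real a + of_real b * h"] by simp
  moreover have "cmod (m_inf (- \<i>) + cnj h) = cmod (m_inf \<i> + h)"
    "cmod (m_inf (- \<i>) + h) = cmod (m_inf \<i> + cnj h)"
    using complex_mod_cnj[of "m_inf \<i> + h"] complex_mod_cnj[of "m_inf \<i> + cnj h"]
    by (simp_all add: weyl_function_cnj_i)
  ultimately show ?thesis using ab by (simp add: norm_mult norm_divide)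
qed

end

context nonneg_schroedinger_limit
begin

text \<open>The sharp lower bound tested on the Weyl solution at \<open>\<i>\<close>, whose energy has real part \<open>Re (m_inf \<i>)\<close>. This is what
  keeps the entropy finite: the transfer function can vanish at \<open>- \<i>\<close> only for \<open>h = - m_inf \<i>\<close>, which would make
  \<open>Re h + m\<close> nonpositive.\<close>

lemma weyl_function_Re_i: "m \<le> Re (m_inf \<i>)"
proof -
  obtain \<psi> where \<psi>: "\<psi> \<in> D" "\<psi> l = -1" "D1 l \<psi> l = m_inf \<i>"
    "\<And>f. L2 l f \<Longrightarrow> ip l (L \<psi>) f = \<i> * ip l \<psi> f"
    using weyl_solution[OF i_not_nonneg(1)] by blast
  have "ip l (L \<psi>) \<psi> = \<i> * ip l \<psi> \<psi>" using \<psi>(4) DstarD(2)[OF \<psi>(1)] by blast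
  then have "form \<psi> \<psi> = \<i> * ip l \<psi> \<psi> + m_inf \<i>" using \<psi> by (simp add: form_def)
  moreover have "Im (ip l \<psi> \<psi>) = 0" by (subst ip_self_real) simp
  ultimately have "Re (form \<psi> \<psi>) = Re (m_inf \<i>)" by simp
  then show ?thesis using form_lower_bound[OF \<psi>(1)] \<psi>(2) by simp
qed

end

section \<open>The maximal entropy\<close>

text \<open>Cross-multiplied, the difference of the two ratios is \<open>(Q - P) * (r - s)\<^sup>2\<close>; this is the inequality
  \<open>r + s\<^sup>2 / r \<ge> 2 s\<close> in disguise.\<close>

lemma entropy_ratio_minimal:
  fixes r s P Q :: real
  assumes "s > 0" "r > 0" "P < Q" "s + P > 0" "s\<^sup>2 + r\<^sup>2 + 2 * r * Q > 0"
  shows "(s + P) / (s + Q) \<le> (s\<^sup>2 + r\<^sup>2 + 2 * r * P) / (s\<^sup>2 + r\<^sup>2 + 2 * r * Q)"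
    and "(s\<^sup>2 + r\<^sup>2 + 2 * r * P) / (s\<^sup>2 + r\<^sup>2 + 2 * r * Q) = (s + P) / (s + Q) \<Longrightarrow> r = s"
proof -
  have sQ: "s + Q > 0" using assms by simp
  have key: "(s\<^sup>2 + r\<^sup>2 + 2 * r * P) * (s + Q) - (s + P) * (s\<^sup>2 + r\<^sup>2 + 2 * r * Q) = (Q - P) * (r - s)\<^sup>2"
    by (simp add: power2_eq_square algebra_simps)
  have "(Q - P) * (r - s)\<^sup>2 \<ge> 0" using assms by simp
  then show "(s + P) / (s + Q) \<le> (s\<^sup>2 + r\<^sup>2 + 2 * r * P) / (s\<^sup>2 + r\<^sup>2 + 2 * r * Q)"
    using key sQ assms(5) by (simp add: frac_le_eq divide_le_0_iff mult.commute frac_le_eq)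
  assume "(s\<^sup>2 + r\<^sup>2 + 2 * r * P) / (s\<^sup>2 + r\<^sup>2 + 2 * r * Q) = (s + P) / (s + Q)"
  then have "(Q - P) * (r - s)\<^sup>2 = 0"
    using sQ assms(5) key by (simp add: frac_eq_eq)
  then show "r = s" using assms by simp
qed

theorem theorem28:
  fixes l :: real and q :: "real \<Rightarrow> real" and m_inf :: "complex \<Rightarrow> complex"
    and \<beta> A B m D :: real
  assumes "loc_summable l q"
    and "deficiency_indices_1_1 l q"
    and "nonnegative_op l (min_op l q)"
    and "weyl_function l q m_inf"
    and "((\<lambda>t. m_inf (complex_of_real t)) \<longlongrightarrow> complex_of_real m) (at_left 0)"
    and "0 < \<beta>" and "\<beta> < pi / 2"
    and "A = Re (m_inf \<i>)" and "B = - Im (m_inf \<i>)" and "D = (A - m)\<^sup>2 + B\<^sup>2"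
  shows "(\<forall>\<mu> h. has_max_finite_entropy l q \<beta> \<mu> h \<longleftrightarrow>
            h = Complex (cos \<beta> * sqrt D - m) (sin \<beta> * sqrt D)) \<and>
         (\<forall>\<mu> h. has_max_finite_entropy l q \<beta> \<mu> h \<longrightarrow>
            c_entropy (schr_L_system l q \<mu> h) =
              ereal (- (1 / 2) * ln ((sqrt D + (A - m) * cos \<beta> - B * sin \<beta>) /
                                     (sqrt D + (A - m) * cos \<beta> + B * sin \<beta>))))"
proof -
  interpret nonneg_schroedinger_limit l q m_inf m
    using assms by unfold_locales
  have B: "B > 0" using weyl_function_Im_i assms by simp
  have a: "A - m \<ge> 0" using weyl_function_Re_i assms by simp
  have sc: "sin \<beta> > 0" "cos \<beta> > 0" using assms by (auto intro: sin_gt_zero cos_gt_zero)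
  define P Q s where "P = (A - m) * cos \<beta> - B * sin \<beta>" and "Q = (A - m) * cos \<beta> + B * sin \<beta>" and "s = sqrt D"
  have D: "D > 0" using B assms(10) by (simp add: add_nonneg_pos)
  have s: "s > 0" "s\<^sup>2 = D" using D by (auto simp: s_def)
  have PQ: "P < Q" using B sc by (simp add: P_def Q_def)
  \<comment> \<open>The numerator of the squared modulus is a sum of squares; the first is positive because \<open>A \<ge> m\<close>.\<close>
  have num: "s\<^sup>2 + r\<^sup>2 + 2 * r * P > 0" if "r > 0" for r
  proof -
    have "s\<^sup>2 + r\<^sup>2 + 2 * r * P = ((A - m) + r * cos \<beta>)\<^sup>2 + (r * sin \<beta> - B)\<^sup>2"
    proof -
      have "(cos \<beta>)\<^sup>2 + (sin \<beta>)\<^sup>2 = 1" by simp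
      then show ?thesis unfolding s(2) assms(10) P_def by algebra
    qed
    moreover have "(A - m) + r * cos \<beta> > 0" using a sc that by (simp add: add_nonneg_pos)
    ultimately show ?thesis by (simp add: add_pos_nonneg)
  qed
  have den: "s\<^sup>2 + r\<^sup>2 + 2 * r * Q > 0" if "r > 0" for r
  proof -
    have "2 * r * P < 2 * r * Q" using PQ that by simp
    with num[OF that] show ?thesis by linarith
  qed
  have sP: "s + P > 0"
  proof -
    have "2 * s * (s + P) > 0" using num[OF s(1)] by (simp add: power2_eq_square algebra_simps)
    then show ?thesis using s(1) by (simp add: zero_less_mult_iff)
  qed
  define \<rho> where "\<rho> r = (s\<^sup>2 + r\<^sup>2 + 2 * r * P) / (s\<^sup>2 + r\<^sup>2 + 2 * r * Q)" for r
  have \<rho>s: "\<rho> s = (s + P) / (s + Q)"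
  proof -
    have "\<rho> s = (2 * s * (s + P)) / (2 * s * (s + Q))" by (simp add: \<rho>_def power2_eq_square algebra_simps)
    then show ?thesis using s(1) by simp
  qed
  \<comment> \<open>The sectorial operators form the open ray from \<open>- m\<close> in direction \<open>exp (\<i> \<beta>)\<close>.\<close>
  define H where "H r = Complex (cos \<beta> * r - m) (sin \<beta> * r)" for r
  have params: "(\<mu>, h) \<in> sectorial_params l q \<beta> \<longleftrightarrow> (\<exists>r>0. h = H r)" for \<mu> h
  proof -
    have "(\<mu>, h) \<in> sectorial_params l q \<beta> \<longleftrightarrow> Im h > 0 \<and> Re h + m > 0 \<and> tan \<beta> = Im h / (Re h + m)"
      using sectorial_iff[of h \<beta>] assms by (auto simp: sectorial_params_def schr_L_system_def)
    also have "\<dots> \<longleftrightarrow> (\<exists>r>0. h = H r)"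
    proof
      assume h: "Im h > 0 \<and> Re h + m > 0 \<and> tan \<beta> = Im h / (Re h + m)"
      have "sin \<beta> * ((Re h + m) / cos \<beta>) = tan \<beta> * (Re h + m)" by (simp add: tan_def)
      also have "\<dots> = Im h" using h by simp
      finally have "sin \<beta> * ((Re h + m) / cos \<beta>) = Im h" .
      then have "h = H ((Re h + m) / cos \<beta>)" using sc by (simp add: H_def complex_eq_iff)
      moreover have "(Re h + m) / cos \<beta> > 0" using h sc by simp
      ultimately show "\<exists>r>0. h = H r" by blast
    next
      assume "\<exists>r>0. h = H r"
      then show "Im h > 0 \<and> Re h + m > 0 \<and> tan \<beta> = Im h / (Re h + m)"
        using sc by (auto simp: H_def tan_def)
    qed
    finally show ?thesis .
  qed
  have entropy: "c_entropy (schr_L_system l q \<mu> (H r)) = ereal (- (1/2) * ln (\<rho> r))" if r: "r > 0" for \<mu> r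
  proof -
    let ?W = "transfer_function (schr_L_system l q \<mu> (H r)) (- \<i>)"
    have "Im (H r) > 0" using sc r by (simp add: H_def)
    from cmod_transfer_function[OF this]
    have "(cmod ?W)\<^sup>2 = (cmod (m_inf \<i> + H r))\<^sup>2 / (cmod (m_inf \<i> + cnj (H r)))\<^sup>2"
      by (simp add: power_divide)
    also have "(cmod (m_inf \<i> + H r))\<^sup>2 = s\<^sup>2 + r\<^sup>2 + 2 * r * P"
    proof -
      have "(cos \<beta>)\<^sup>2 + (sin \<beta>)\<^sup>2 = 1" by simp
      then have "(A + (cos \<beta> * r - m))\<^sup>2 + (sin \<beta> * r - B)\<^sup>2 = s\<^sup>2 + r\<^sup>2 + 2 * r * P"
        unfolding s(2) assms(10) P_def by algebra
      then show ?thesis unfolding cmod_power2 assms(8,9) by (simp add: H_def power2_eq_square algebra_simps)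
    qed
    also have "(cmod (m_inf \<i> + cnj (H r)))\<^sup>2 = s\<^sup>2 + r\<^sup>2 + 2 * r * Q"
    proof -
      have "(cos \<beta>)\<^sup>2 + (sin \<beta>)\<^sup>2 = 1" by simp
      then have "(A + (cos \<beta> * r - m))\<^sup>2 + (sin \<beta> * r + B)\<^sup>2 = s\<^sup>2 + r\<^sup>2 + 2 * r * Q"
        unfolding s(2) assms(10) Q_def by algebra
      then show ?thesis unfolding cmod_power2 assms(8,9) by (simp add: H_def power2_eq_square algebra_simps)
    qed
    finally have W: "(cmod ?W)\<^sup>2 = \<rho> r" by (simp add: \<rho>_def)
    have "\<rho> r > 0" using num[OF r] den[OF r] by (simp add: \<rho>_def)
    then have "?W \<noteq> 0" using W by auto
    then have "ln (\<rho> r) = 2 * ln (cmod ?W)" unfolding W[symmetric] by (simp add: ln_realpow)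
    then show ?thesis using \<open>?W \<noteq> 0\<close> by (simp add: c_entropy_def)
  qed
  have \<rho>pos: "\<rho> r > 0" if "r > 0" for r using num[OF that] den[OF that] by (simp add: \<rho>_def)
  have max: "has_max_finite_entropy l q \<beta> \<mu> h \<longleftrightarrow> h = H s" for \<mu> h
  proof
    assume M: "has_max_finite_entropy l q \<beta> \<mu> h"
    then have "(\<mu>, h) \<in> sectorial_params l q \<beta>" unfolding has_max_finite_entropy_def by blast
    from iffD1[OF params this] obtain r where r: "r > 0" "h = H r" by blast
    have "(\<mu>, H s) \<in> sectorial_params l q \<beta>" by (rule iffD2[OF params]) (use s(1) in blast)
    then have "c_entropy (schr_L_system l q \<mu> (H s)) \<le> c_entropy (schr_L_system l q \<mu> h)"
      using M unfolding has_max_finite_entropy_def by blast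
    then have "ln (\<rho> r) \<le> ln (\<rho> s)" unfolding r(2) entropy[OF s(1)] entropy[OF r(1)] by simp
    then have "\<rho> r \<le> \<rho> s" using \<rho>pos r(1) s(1) by simp
    moreover have "\<rho> s \<le> \<rho> r" unfolding \<rho>s unfolding \<rho>_def
      by (rule entropy_ratio_minimal(1)[OF s(1) r(1) PQ sP den[OF r(1)]])
    ultimately have "\<rho> r = (s + P) / (s + Q)" using \<rho>s by simp
    then have "r = s" unfolding \<rho>_def
      by (rule entropy_ratio_minimal(2)[OF s(1) r(1) PQ sP den[OF r(1)]])
    then show "h = H s" using r by simp
  next
    assume h: "h = H s"
    have "c_entropy (schr_L_system l q \<mu>' h') \<le> c_entropy (schr_L_system l q \<mu> h)"
      if in_params: "(\<mu>', h') \<in> sectorial_params l q \<beta>" for \<mu>' h'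
    proof -
      obtain r where r: "r > 0" "h' = H r" using iffD1[OF params in_params] by blast
      have "\<rho> s \<le> \<rho> r" unfolding \<rho>s unfolding \<rho>_def
        by (rule entropy_ratio_minimal(1)[OF s(1) r(1) PQ sP den[OF r(1)]])
      then have "ln (\<rho> s) \<le> ln (\<rho> r)" using \<rho>pos r(1) s(1) by simp
      then show ?thesis unfolding h r(2) entropy[OF s(1)] entropy[OF r(1)] by simp
    qed
    moreover have "c_entropy (schr_L_system l q \<mu> h) < \<infinity>" unfolding h entropy[OF s(1)] by simp
    moreover have "(\<mu>, h) \<in> sectorial_params l q \<beta>" by (rule iffD2[OF params]) (use s(1) h in blast)
    ultimately show "has_max_finite_entropy l q \<beta> \<mu> h" unfolding has_max_finite_entropy_def by blast
  qed
  have "c_entropy (schr_L_system l q \<mu> (H s)) = ereal (- (1 / 2) * ln ((sqrt D + (A - m) * cos \<beta> - B * sin \<beta>) /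
                                     (sqrt D + (A - m) * cos \<beta> + B * sin \<beta>)))" for \<mu>
    unfolding entropy[OF s(1)] \<rho>s by (simp add: P_def Q_def s_def algebra_simps)
  moreover have "H s = Complex (cos \<beta> * sqrt D - m) (sin \<beta> * sqrt D)" by (simp add: H_def s_def)
  ultimately show ?thesis unfolding max by (simp only: simp_thms)
qed

end
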